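(* Let $f\in L^1\cap L^2(\mathbb{R}^2,\mathbb{H})$ be written as $f(x)=|f(x)|_Qe^{u(x)\theta(x)}$, with $u(x)$ a pure unit quaternion and $\theta(x)$ real, where $|f|_Q$ and $e^{u\theta}$ are differentiable with respect to $x_k$, $k\in\{1,2\}$. Suppose $\frac{\partial}{\partial x_k}f$ exists and lies in $L^2(\mathbb{R}^2,\mathbb{H})$. Then $$(2\pi)^2\int_{\mathbb{R}^2}\xi_k^2\,\|\mathcal{F}\{f\}(\xi)\|_Q^2\,d\xi=\int_{\mathbb{R}^2}\Big(\frac{\partial}{\partial x_k}|f(x)|_Q\Big)^2dx+\int_{\mathbb{R}^2}|f(x)|_Q^2\,\Big|\frac{\partial}{\partial x_k}e^{u(x)\theta(x)}\Big|_Q^2\,dx .$$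
   Context: $\mathbb{H}$ denotes the real quaternion algebra with basis $1,i,j,k$, where $i^2=j^2=k^2=-1$, $ij=-ji=k$, $jk=-kj=i$, $ki=-ik=j$. For $q=q_0+iq_1+jq_2+kq_3$, $\bar q=q_0-iq_1-jq_2-kq_3$ and $|q|_Q=\sqrt{q\bar q}$. For a pure unit quaternion $\mu$, $e^{\mu\theta}=\cos\theta+\mu\sin\theta$. The two-sided quaternion Fourier transform is $$\mathcal{F}\{f\}(\xi)=\int_{\mathbb{R}^2}e^{-2\pi i\xi_1x_1}f(x)e^{-2\pi j\xi_2x_2}\,dx ,$$ and, writing $f=f_0+if_1+jf_2+kf_3$ with real $f_m$, $$\|\mathcal{F}\{f\}(\xi)\|_Q:=\Big(\sum_{m=0}^3|\mathcal{F}\{f_m\}(\xi)|_Q^2\Big)^{1/2}.$$ *)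

theory Defs
  imports "HOL-Analysis.Analysis"
begin

text \<open>Real quaternions q = q0 + i q1 + j q2 + k q3, represented by their four real
  coordinates (q0, q1, q2, q3).  The product type carries the Euclidean
  (real_normed_vector / banach) structure needed for Bochner integration.\<close>

type_synonym quat = "real \<times> real \<times> real \<times> real"

definition qreal :: "real \<Rightarrow> quat" where
  "qreal r = (r, 0, 0, 0)"

definition qi :: quat where "qi = (0, 1, 0, 0)"
definition qj :: quat where "qj = (0, 0, 1, 0)"
definition qk :: quat where "qk = (0, 0, 0, 1)"

definition qcomp :: "nat \<Rightarrow> quat \<Rightarrow> real" where
  "qcomp m q = (case q of (q0, q1, q2, q3) \<Rightarrow>
      (if m = 0 then q0 else if m = 1 then q1 else if m = 2 then q2 else q3))"

text \<open>Hamilton product (i^2 = j^2 = k^2 = -1, ij = k, jk = i, ki = j).\<close>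
definition qmul :: "quat \<Rightarrow> quat \<Rightarrow> quat" where
  "qmul p q = (case p of (p0, p1, p2, p3) \<Rightarrow> case q of (q0, q1, q2, q3) \<Rightarrow>
     (p0*q0 - p1*q1 - p2*q2 - p3*q3,
      p0*q1 + p1*q0 + p2*q3 - p3*q2,
      p0*q2 - p1*q3 + p2*q0 + p3*q1,
      p0*q3 + p1*q2 - p2*q1 + p3*q0))"

definition qcnj :: "quat \<Rightarrow> quat" where
  "qcnj q = (case q of (q0, q1, q2, q3) \<Rightarrow> (q0, -q1, -q2, -q3))"

text \<open>Modulus |q|_Q = sqrt (q * conj q) (q * conj q is real, i.e. its scalar part).\<close>
definition qabs :: "quat \<Rightarrow> real" where
  "qabs q = sqrt (qcomp 0 (qmul q (qcnj q)))"

definition pure_unit :: "quat \<Rightarrow> bool" where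
  "pure_unit \<mu> \<longleftrightarrow> qcomp 0 \<mu> = 0 \<and> qabs \<mu> = 1"

definition qexp :: "quat \<Rightarrow> real \<Rightarrow> quat" where
  "qexp \<mu> \<theta> = qreal (cos \<theta>) + sin \<theta> *\<^sub>R \<mu>"

definition qft :: "(real^2 \<Rightarrow> quat) \<Rightarrow> real^2 \<Rightarrow> quat" where
  "qft f \<xi> = (\<integral>x. qmul (qmul (qexp qi (-2 * pi * (\<xi>$1) * (x$1))) (f x))
                          (qexp qj (-2 * pi * (\<xi>$2) * (x$2))) \<partial>lborel)"

definition qft_norm :: "(real^2 \<Rightarrow> quat) \<Rightarrow> real^2 \<Rightarrow> real" where
  "qft_norm f \<xi> = sqrt (\<Sum>m<4. (qabs (qft (\<lambda>x. qreal (qcomp m (f x))) \<xi>))\<^sup>2)"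

definition partial_differentiable :: "2 \<Rightarrow> (real^2 \<Rightarrow> 'a::real_normed_vector) \<Rightarrow> real^2 \<Rightarrow> bool" where
  "partial_differentiable k g x \<longleftrightarrow> (\<lambda>t. g (x + t *\<^sub>R axis k 1)) differentiable (at 0)"

definition pdiff :: "2 \<Rightarrow> (real^2 \<Rightarrow> 'a::real_normed_vector) \<Rightarrow> real^2 \<Rightarrow> 'a" where
  "pdiff k g x = vector_derivative (\<lambda>t. g (x + t *\<^sub>R axis k 1)) (at 0)"

definition qL1 :: "(real^2 \<Rightarrow> quat) \<Rightarrow> bool" where
  "qL1 g \<longleftrightarrow> integrable lborel g"

definition qL2 :: "(real^2 \<Rightarrow> quat) \<Rightarrow> bool" where
  "qL2 g \<longleftrightarrow> g \<in> borel_measurable lborel \<and> integrable lborel (\<lambda>x. (qabs (g x))\<^sup>2)"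

end

theory Submission
  imports Defs "HOL-Probability.Characteristic_Functions"
begin

text \<open>Writing \<open>f = \<bar>f\<bar> e\<close> with \<open>\<bar>e\<bar> = 1\<close>, the vectors \<open>e\<close> and \<open>\<partial>e\<close> are orthogonal, so
  \<open>\<bar>\<partial>f\<bar>\<^sup>2 = (\<partial>\<bar>f\<bar>)\<^sup>2 + \<bar>f\<bar>\<^sup>2 \<bar>\<partial>e\<bar>\<^sup>2\<close> pointwise. For a real component \<open>g\<close> of \<open>f\<close>, the squared modulus
  of the quaternion transform at \<open>\<xi>\<close> is the mean of the squared moduli of the complex transform at \<open>\<xi>\<close>
  and at its reflection in the second coordinate, so everything reduces to
  \<open>\<integral> (2 \<pi> \<xi> \<bullet> v)\<^sup>2 \<bar>\<F> g\<bar>\<^sup>2 = \<integral> (\<partial>\<^sub>v g)\<^sup>2\<close>. This follows from Plancherel's identity for the difference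
  quotients \<open>D\<^sub>h g\<close>: since \<open>\<bar>2 sin (\<pi> h \<xi> \<bullet> v) / h\<bar> \<le> \<bar>2 \<pi> \<xi> \<bullet> v\<bar>\<close> and, by the fundamental theorem
  of calculus along lines, \<open>\<parallel>D\<^sub>h g\<parallel> \<le> \<parallel>\<partial>\<^sub>v g\<parallel>\<close>, Fatou's lemma on either side gives the two inequalities.

  For Plancherel's identity, \<open>\<bar>\<F> g\<bar>\<^sup>2\<close> is the transform of the autocorrelation \<open>A\<close> of \<open>g\<close>, so its integral
  against a Gaussian weight is an average of \<open>A\<close> near \<open>0\<close>; as the weight tends to \<open>1\<close> this tends to
  \<open>A(0) = \<parallel>g\<parallel>\<^sup>2\<close>, because translation is continuous in mean square.\<close>

section \<open>Translations\<close>

lemma borel_measurable_lborel_integrable: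
  "integrable lborel f \<Longrightarrow> f \<in> borel_measurable borel"
  using borel_measurable_integrable[of lborel f] by simp

lemma nn_integral_lborel_translate:
  fixes f :: "'a::euclidean_space \<Rightarrow> ennreal"
  assumes "f \<in> borel_measurable borel"
  shows "(\<integral>\<^sup>+x. f (c + x) \<partial>lborel) = (\<integral>\<^sup>+x. f x \<partial>lborel)"
  by (subst (2) lborel_distr_plus[of c, symmetric]) (simp add: nn_integral_distr assms)

lemma lborel_integrable_translate:
  fixes f :: "'a::euclidean_space \<Rightarrow> 'b::{banach, second_countable_topology}"
  assumes "integrable lborel f"
  shows "integrable lborel (\<lambda>x. f (c + x))"
  using assms integrable_distr[of "(+) c" lborel lborel f] lborel_distr_plus[of c]
  by (simp cong: distr_cong)

lemma lborel_integral_translate: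
  fixes f :: "'a::euclidean_space \<Rightarrow> 'b::{banach, second_countable_topology}"
  assumes "f \<in> borel_measurable borel"
  shows "(\<integral>x. f (c + x) \<partial>lborel) = (\<integral>x. f x \<partial>lborel)"
  by (subst (2) lborel_distr_plus[of c, symmetric]) (simp add: integral_distr assms)

section \<open>Continuity of translation in the mean\<close>

lemma translate_approx:
  fixes f g :: "'a::euclidean_space \<Rightarrow> real"
  assumes f: "integrable lborel f" and g: "integrable lborel g"
  shows "(\<integral>x. \<bar>f (c + x) - f x\<bar> \<partial>lborel)
       \<le> (\<integral>x. \<bar>g (c + x) - g x\<bar> \<partial>lborel) + 2 * (\<integral>x. \<bar>f x - g x\<bar> \<partial>lborel)"
proof -
  note i = f g lborel_integrable_translate[OF f, of c] lborel_integrable_translate[OF g, of c]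
  have m: "(\<lambda>x. \<bar>f x - g x\<bar>) \<in> borel_measurable borel"
    using borel_measurable_integrable[OF f] borel_measurable_integrable[OF g] by simp
  have "(\<integral>x. \<bar>f (c + x) - f x\<bar> \<partial>lborel)
      \<le> (\<integral>x. \<bar>g (c + x) - g x\<bar> + \<bar>f (c + x) - g (c + x)\<bar> + \<bar>f x - g x\<bar> \<partial>lborel)"
    by (intro integral_mono Bochner_Integration.integrable_add integrable_abs
        Bochner_Integration.integrable_diff i) auto
  also have "\<dots> = (\<integral>x. \<bar>g (c + x) - g x\<bar> \<partial>lborel)
      + (\<integral>x. \<bar>f (c + x) - g (c + x)\<bar> \<partial>lborel) + (\<integral>x. \<bar>f x - g x\<bar> \<partial>lborel)"
    using i by simp
  \<comment> \<open>Translation invariance makes both error terms equal, hence the factor 2 in the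
    bound.\<close>
  also have "(\<integral>x. \<bar>f (c + x) - g (c + x)\<bar> \<partial>lborel) = (\<integral>x. \<bar>f x - g x\<bar> \<partial>lborel)"
    using lborel_integral_translate[OF m] .
  finally show ?thesis by simp
qed

text \<open>For a fixed sequence of shifts, the functions with the asserted convergence are closed
  under L^1 approximation. This serves twice in \<open>L1_translation_continuous\<close>: from open
  to measurable sets, and for pointwise limits.\<close>

lemma L1_translation_approx_limit:
  fixes f :: "'a::euclidean_space \<Rightarrow> real"
  assumes f: "integrable lborel f"
    and approx: "\<And>e. e > 0 \<Longrightarrow> \<exists>g. integrable lborel g \<and> (\<integral>x. \<bar>f x - g x\<bar> \<partial>lborel) < e \<and>
        (\<lambda>n. \<integral>x. \<bar>g (h n + x) - g x\<bar> \<partial>lborel) \<longlonglongrightarrow> 0"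
  shows "(\<lambda>n. \<integral>x. \<bar>f (h n + x) - f x\<bar> \<partial>lborel) \<longlonglongrightarrow> 0"
proof (rule LIMSEQ_I)
  fix e :: real assume e: "e > 0"
  \<comment> \<open>The approximation error enters twice, so \<open>e / 4\<close> leaves
    \<open>e / 2\<close> for the translates of \<open>g\<close>.\<close>
  obtain g where g: "integrable lborel g" "(\<integral>x. \<bar>f x - g x\<bar> \<partial>lborel) < e / 4"
    and lim: "(\<lambda>n. \<integral>x. \<bar>g (h n + x) - g x\<bar> \<partial>lborel) \<longlonglongrightarrow> 0"
    using approx[of "e / 4"] e by auto
  obtain N where N: "\<And>n. n \<ge> N \<Longrightarrow> norm ((\<integral>x. \<bar>g (h n + x) - g x\<bar> \<partial>lborel) - 0) < e / 2"
    using LIMSEQ_D[OF lim, of "e / 2"] e by auto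
  show "\<exists>N. \<forall>n\<ge>N. norm ((\<integral>x. \<bar>f (h n + x) - f x\<bar> \<partial>lborel) - 0) < e"
  proof (intro exI allI impI)
    fix n assume "n \<ge> N"
    then show "norm ((\<integral>x. \<bar>f (h n + x) - f x\<bar> \<partial>lborel) - 0) < e"
      using N[of n] translate_approx[OF f g(1), of "h n"] g(2) by simp
  qed
qed

text \<open>For open \<open>U\<close> the product of the indicators of \<open>U - h\<close> and \<open>U\<close> converges pointwise to that of \<open>U\<close>,
  so dominated convergence suffices and no inner regularity is needed.\<close>

lemma L1_translation_open:
  fixes U :: "'a::euclidean_space set"
  assumes U: "open U" "emeasure lborel U < \<infinity>" and h: "h \<longlonglongrightarrow> 0"
  shows "(\<lambda>n. \<integral>x. \<bar>indicator U (h n + x) - indicator U x :: real\<bar> \<partial>lborel) \<longlonglongrightarrow> 0"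
proof -
  let ?i = "indicator U :: 'a \<Rightarrow> real"
  have iU: "integrable lborel ?i" using U by simp
  have Um[measurable]: "U \<in> sets borel" using U by simp
  note it = lborel_integrable_translate[OF iU]
  have imin: "integrable lborel (\<lambda>x. ?i (c + x) * ?i x)" for c
    by (rule Bochner_Integration.integrable_bound[OF iU]) (auto simp: indicator_def)
  have lim: "(\<lambda>n. \<integral>x. ?i (h n + x) * ?i x \<partial>lborel) \<longlonglongrightarrow> (\<integral>x. ?i x \<partial>lborel)"
  proof (rule integral_dominated_convergence[where w = ?i])
    show "AE x in lborel. (\<lambda>n. ?i (h n + x) * ?i x) \<longlonglongrightarrow> ?i x"
    proof (rule AE_I2)
      fix x
      show "(\<lambda>n. ?i (h n + x) * ?i x) \<longlonglongrightarrow> ?i x"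
      proof (cases "x \<in> U")
        case True
        have "(\<lambda>n. h n + x) \<longlonglongrightarrow> 0 + x" by (intro tendsto_intros h)
        then have "eventually (\<lambda>n. h n + x \<in> U) sequentially"
          using U(1) True topological_tendstoD by fastforce
        then have "eventually (\<lambda>n. ?i (h n + x) * ?i x = ?i x) sequentially"
          by eventually_elim simp
        then show ?thesis by (rule tendsto_eventually)
      qed simp
    qed
  qed (use iU in \<open>auto simp: indicator_def\<close>)
  \<comment> \<open>Since \<open>\<bar>a - b\<bar> = a + b - 2 * a * b\<close> for values in {0, 1},
    only the overlap of \<open>U\<close> with its translate depends on \<open>c\<close>.\<close>
  have eq: "(\<integral>x. \<bar>?i (c + x) - ?i x\<bar> \<partial>lborel)
      = 2 * (\<integral>x. ?i x \<partial>lborel) - 2 * (\<integral>x. ?i (c + x) * ?i x \<partial>lborel)" for c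
  proof -
    have "(\<integral>x. \<bar>?i (c + x) - ?i x\<bar> \<partial>lborel)
        = (\<integral>x. ?i (c + x) + ?i x - 2 * (?i (c + x) * ?i x) \<partial>lborel)"
      by (intro Bochner_Integration.integral_cong) (auto simp: indicator_def)
    also have "\<dots> = (\<integral>x. ?i (c + x) \<partial>lborel) + (\<integral>x. ?i x \<partial>lborel)
        - 2 * (\<integral>x. ?i (c + x) * ?i x \<partial>lborel)"
      using it[of c] iU imin[of c] by simp
    also have "(\<integral>x. ?i (c + x) \<partial>lborel) = (\<integral>x. ?i x \<partial>lborel)"
      by (rule lborel_integral_translate) simp
    finally show ?thesis by simp
  qed
  show ?thesis unfolding eq by (rule tendsto_eq_intros lim refl)+ simp
qed

text \<open>Induction on integrable functions: outer regularity approximates an indicator by that of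
  an open set, the triangle inequality handles sums, and dominated convergence turns a pointwise
  limit into an L^1 limit.\<close>

proposition L1_translation_continuous:
  fixes f :: "'a::euclidean_space \<Rightarrow> real"
  assumes "integrable lborel f" and h: "h \<longlonglongrightarrow> 0"
  shows "(\<lambda>n. \<integral>x. \<bar>f (h n + x) - f x\<bar> \<partial>lborel) \<longlonglongrightarrow> 0"
  using assms(1)
proof (induction rule: integrable_induct)
  case (base A c)
  have A: "A \<in> sets borel" using base by simp
  have iA: "integrable lborel (indicator A :: 'a \<Rightarrow> real)" using base by simp
  have ind: "(\<lambda>n. \<integral>x. \<bar>indicator A (h n + x) - indicator A x :: real\<bar> \<partial>lborel) \<longlonglongrightarrow> 0"
  proof (rule L1_translation_approx_limit[OF iA])
    fix e :: real assume e: "e > 0"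
    obtain U where U: "open U" "A \<subseteq> U" "emeasure lborel (U - A) < e"
      using outer_regular_lborel[OF A e] by metis
    have Um[measurable]: "U \<in> sets borel" using U by simp
    \<comment> \<open>\<open>U\<close> inherits finite measure from \<open>A\<close> because
      \<open>U - A\<close> has measure below \<open>e\<close>; only then does the case of open sets
      apply.\<close>
    have "emeasure lborel U \<le> emeasure lborel A + emeasure lborel (U - A)"
      using emeasure_subadditive[of A lborel "U - A"] A U
      by (simp add: Un_absorb1)
    also have "\<dots> < \<infinity>" using base(2) U(3) by (simp add: less_top[symmetric]) (metis ennreal_less_top less_imp_neq order_less_trans)
    finally have fU: "emeasure lborel U < \<infinity>" .
    have "(\<integral>x. \<bar>indicator A x - indicator U x :: real\<bar> \<partial>lborel) = (\<integral>x. indicator (U - A) x \<partial>lborel)"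
      using U(2) by (intro Bochner_Integration.integral_cong) (auto simp: indicator_def)
    also have "\<dots> = measure lborel (U - A)" by simp
    also have "\<dots> < e"
    proof -
      have "ennreal (measure lborel (U - A)) < ennreal e"
        using U(3) by (subst emeasure_eq_ennreal_measure[symmetric]) auto
      then show ?thesis by (simp add: ennreal_less_iff)
    qed
    finally show "\<exists>g. integrable lborel g \<and> (\<integral>x. \<bar>indicator A x - g x\<bar> \<partial>lborel) < e \<and>
        (\<lambda>n. \<integral>x. \<bar>g (h n + x) - g x\<bar> \<partial>lborel) \<longlonglongrightarrow> 0"
      using L1_translation_open[OF U(1) fU h] fU
      by (intro exI[of _ "indicator U"]) simp
  qed
  have "\<bar>indicator A (h n + x) *\<^sub>R c - indicator A x *\<^sub>R c\<bar>
      = \<bar>c\<bar> * \<bar>indicator A (h n + x) - indicator A x\<bar>" for n x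
    by (simp add: abs_mult[symmetric] algebra_simps)
  then show ?case using tendsto_mult_right_zero[OF ind, of "\<bar>c\<bar>"] by simp
next
  case (add f g)
  note i = add(1,2) lborel_integrable_translate[OF add(1)] lborel_integrable_translate[OF add(2)]
  show ?case
  proof (rule tendsto_sandwich[OF _ _ tendsto_const])
    show "(\<lambda>n. (\<integral>x. \<bar>f (h n + x) - f x\<bar> \<partial>lborel) + (\<integral>x. \<bar>g (h n + x) - g x\<bar> \<partial>lborel)) \<longlonglongrightarrow> 0"
      using tendsto_add[OF add(3,4)] by simp
    have "(\<integral>x. \<bar>f (h n + x) + g (h n + x) - (f x + g x)\<bar> \<partial>lborel)
        \<le> (\<integral>x. \<bar>f (h n + x) - f x\<bar> + \<bar>g (h n + x) - g x\<bar> \<partial>lborel)" for n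
      by (intro integral_mono Bochner_Integration.integrable_add integrable_abs
          Bochner_Integration.integrable_diff i) auto
    then show "\<forall>\<^sub>F n in sequentially. (\<integral>x. \<bar>f (h n + x) + g (h n + x) - (f x + g x)\<bar> \<partial>lborel)
        \<le> (\<integral>x. \<bar>f (h n + x) - f x\<bar> \<partial>lborel) + (\<integral>x. \<bar>g (h n + x) - g x\<bar> \<partial>lborel)"
      using i by simp
  qed simp
next
  case (lim f s)
  show ?case
  proof (rule L1_translation_approx_limit[OF lim(4)])
    fix e :: real assume e: "e > 0"
    have "(\<lambda>i. \<integral>x. \<bar>f x - s i x\<bar> \<partial>lborel) \<longlonglongrightarrow> (\<integral>x. 0 \<partial>(lborel :: 'a measure))"
    proof (rule integral_dominated_convergence[where w = "\<lambda>x. 3 * \<bar>f x\<bar>"])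
      show "AE x in lborel. (\<lambda>i. \<bar>f x - s i x\<bar>) \<longlonglongrightarrow> 0"
      proof (rule AE_I2)
        fix x
        have "(\<lambda>i. \<bar>f x - s i x\<bar>) \<longlonglongrightarrow> \<bar>f x - f x\<bar>"
          by (intro tendsto_intros lim(2)) simp
        then show "(\<lambda>i. \<bar>f x - s i x\<bar>) \<longlonglongrightarrow> 0" by simp
      qed
      \<comment> \<open>The factor 3 comes from the bound
        \<open>\<bar>s i x\<bar> \<le> 2 * \<bar>f x\<bar>\<close> of the induction rule.\<close>
      show "AE x in lborel. norm \<bar>f x - s i x\<bar> \<le> 3 * \<bar>f x\<bar>" for i
        using lim(3)[of _ i] by (intro AE_I2) (smt (verit) UNIV_I real_norm_def space_lborel)
    qed (use lim(1,4) in \<open>auto intro!: borel_measurable_integrable\<close>)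
    then obtain i where "(\<integral>x. \<bar>f x - s i x\<bar> \<partial>lborel) < e"
      using LIMSEQ_D[of _ 0 e] e by fastforce
    then show "\<exists>g. integrable lborel g \<and> (\<integral>x. \<bar>f x - g x\<bar> \<partial>lborel) < e \<and>
        (\<lambda>n. \<integral>x. \<bar>g (h n + x) - g x\<bar> \<partial>lborel) \<longlonglongrightarrow> 0"
      using lim(1,5) by blast
  qed
qed

section \<open>Autocorrelation and the Fourier transform\<close>

text \<open>Carries continuity of translation from \<open>L\<^sup>1\<close>, applied to \<open>g \<bar>g\<bar>\<close>, over to \<open>L\<^sup>2\<close>.\<close>

lemma power2_diff_le_signed_squares:
  fixes a b :: real
  shows "(a - b)\<^sup>2 \<le> 2 * \<bar>a * \<bar>a\<bar> - b * \<bar>b\<bar>\<bar>"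
proof -
  have double: "r \<le> 2 * t" if "r \<le> t" "0 \<le> t" for r t :: real
    using that by simp
  have same: "(c - d)\<^sup>2 \<le> 2 * \<bar>c * c - d * d\<bar>" if "0 \<le> c" "0 \<le> d" for c d :: real
  proof -
    have "(c - d)\<^sup>2 = \<bar>c - d\<bar> * \<bar>c - d\<bar>" by (simp add: power2_eq_square)
    also have "\<dots> \<le> \<bar>c - d\<bar> * \<bar>c + d\<bar>" by (rule mult_left_mono) (use that in auto)
    also have "\<dots> = \<bar>c * c - d * d\<bar>"
      by (simp only: abs_mult[symmetric] square_diff_square_factored mult.commute)
    finally show ?thesis by (rule double) simp
  qed
  \<comment> \<open>For opposite signs the difference of signed squares is a sum of squares up to
    sign; this case forces the factor 2.\<close>
  have opp: "(c + d)\<^sup>2 \<le> 2 * \<bar>c * c + d * d\<bar>" for c d :: real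
    using sum_squares_bound[of c d] by (simp add: power2_eq_square algebra_simps)
  consider "0 \<le> a" "0 \<le> b" | "a \<le> 0" "b \<le> 0" | "0 \<le> a" "b \<le> 0" | "a \<le> 0" "0 \<le> b"
    by linarith
  then show ?thesis
  proof cases
    case 1
    then show ?thesis using same[of a b] by (simp only: abs_of_nonneg)
  next
    case 2
    then have "\<bar>a * \<bar>a\<bar> - b * \<bar>b\<bar>\<bar> = \<bar>(- a) * (- a) - (- b) * (- b)\<bar>"
      by (simp add: abs_of_nonpos abs_minus_commute)
    then show ?thesis using same[of "- a" "- b"] 2 by (simp add: power2_commute)
  next
    case 3
    then have "a * \<bar>a\<bar> - b * \<bar>b\<bar> = a * a + (- b) * (- b)" by (simp only: abs_of_nonneg abs_of_nonpos)
    then show ?thesis using opp[of a "- b"] by simp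
  next
    case 4
    then have "a * \<bar>a\<bar> - b * \<bar>b\<bar> = - ((- a) * (- a) + b * b)" by (simp only: abs_of_nonneg abs_of_nonpos)
    then show ?thesis using opp[of "- a" b] by (simp only: abs_minus_cancel) (simp add: power2_commute)
  qed
qed

definition autocorr :: "('a::euclidean_space \<Rightarrow> real) \<Rightarrow> 'a \<Rightarrow> real" where
  "autocorr g v = (\<integral>x. g (v + x) * g x \<partial>lborel)"

lemma integrable_mult_L2:
  fixes f g :: "'a \<Rightarrow> real"
  assumes [measurable]: "f \<in> borel_measurable M" "g \<in> borel_measurable M"
    and "integrable M (\<lambda>x. (f x)\<^sup>2)" "integrable M (\<lambda>x. (g x)\<^sup>2)"
  shows "integrable M (\<lambda>x. f x * g x)"
proof (rule Bochner_Integration.integrable_bound)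
  show "integrable M (\<lambda>x. (f x)\<^sup>2 + (g x)\<^sup>2)" using assms by simp
  have "\<bar>a * b\<bar> \<le> a\<^sup>2 + b\<^sup>2" for a b :: real
    using sum_squares_bound[of "\<bar>a\<bar>" "\<bar>b\<bar>"] abs_ge_zero[of "a * b"]
    unfolding power2_abs abs_mult by linarith
  then show "AE x in M. norm (f x * g x) \<le> norm ((f x)\<^sup>2 + (g x)\<^sup>2)" by simp
qed simp

text \<open>Same normalisation of frequencies as in \<open>qft\<close>. Real-valued inputs suffice
  because \<open>qft_norm\<close> transforms the real components separately.\<close>

definition fourier :: "('a::euclidean_space \<Rightarrow> real) \<Rightarrow> 'a \<Rightarrow> complex" where
  "fourier g \<xi> = (\<integral>x. g x *\<^sub>R cis (- (2 * pi) * (\<xi> \<bullet> x)) \<partial>lborel)"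

text \<open>The factor \<open>a\<close> stays free because \<open>gauss_eq_fourier_weight\<close>
  uses -1 where the transform itself has \<open>- (2 * pi)\<close>.\<close>

lemma integrable_fourier_integrand:
  fixes g :: "'a::euclidean_space \<Rightarrow> real"
  assumes L1: "integrable lborel g"
  shows "integrable lborel (\<lambda>x. g x *\<^sub>R cis (a * (\<xi> \<bullet> x)))"
proof (rule Bochner_Integration.integrable_bound[OF L1])
  have "(\<lambda>x. cis (a * (\<xi> \<bullet> x))) \<in> borel_measurable borel"
    by (intro borel_measurable_continuous_onI continuous_intros)
  with borel_measurable_integrable[OF L1] show "(\<lambda>x. g x *\<^sub>R cis (a * (\<xi> \<bullet> x))) \<in> borel_measurable lborel" by simp
qed simp

lemma cis_measurable[measurable]: "cis \<in> borel_measurable borel"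
  by (intro borel_measurable_continuous_onI continuous_intros)

lemma fourier_measurable[measurable]:
  assumes [measurable]: "g \<in> borel_measurable borel"
  shows "fourier g \<in> borel_measurable borel"
proof -
  have "(\<lambda>\<xi>. \<integral>x. g x *\<^sub>R cis (- (2 * pi) * (\<xi> \<bullet> x)) \<partial>lborel) \<in> borel_measurable borel"
    by (rule lborel.borel_measurable_lebesgue_integral) simp
  then show ?thesis unfolding fourier_def[abs_def] .
qed

context
  fixes g :: "'a::euclidean_space \<Rightarrow> real"
  assumes L1: "integrable lborel g" and L2: "integrable lborel (\<lambda>x. (g x)\<^sup>2)"
begin

lemmas [measurable] = borel_measurable_lborel_integrable[OF L1]

lemma L2_translate: "integrable lborel (\<lambda>x. (g (v + x))\<^sup>2)"
  using lborel_integrable_translate[OF L2] .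

lemma integrable_autocorr_integrand: "integrable lborel (\<lambda>x. g (v + x) * g x)"
  by (rule integrable_mult_L2[OF _ _ L2_translate L2]) simp_all

text \<open>Polarisation of the L^2 distance between \<open>g\<close> and its translate. It reduces
  continuity of the autocorrelation at 0 to continuity of translation in L^2.\<close>

lemma autocorr_eq:
  "autocorr g v = (\<integral>x. (g x)\<^sup>2 \<partial>lborel) - (\<integral>x. (g (v + x) - g x)\<^sup>2 \<partial>lborel) / 2"
proof -
  have "(\<integral>x. (g (v + x) - g x)\<^sup>2 \<partial>lborel)
      = (\<integral>x. (g (v + x))\<^sup>2 + (g x)\<^sup>2 - 2 * (g (v + x) * g x) \<partial>lborel)"
    by (simp add: power2_diff mult.assoc)
  also have "\<dots> = (\<integral>x. (g (v + x))\<^sup>2 \<partial>lborel) + (\<integral>x. (g x)\<^sup>2 \<partial>lborel) - 2 * autocorr g v"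
    using L2 L2_translate integrable_autocorr_integrand by (simp add: autocorr_def)
  also have "(\<integral>x. (g (v + x))\<^sup>2 \<partial>lborel) = (\<integral>x. (g x)\<^sup>2 \<partial>lborel)"
    by (rule lborel_integral_translate) simp
  finally show ?thesis by (simp add: field_simps)
qed

text \<open>Follows from \<open>2 * \<bar>a * b\<bar> \<le> a\<^sup>2 + b\<^sup>2\<close> and
  translation invariance. The bound supplies the dominating function in
  \<open>plancherel\<close>.\<close>

lemma abs_autocorr_le: "\<bar>autocorr g v\<bar> \<le> (\<integral>x. (g x)\<^sup>2 \<partial>lborel)"
proof -
  have eq: "(\<integral>x. (g (v + x))\<^sup>2 \<partial>lborel) = (\<integral>x. (g x)\<^sup>2 \<partial>lborel)"
    by (rule lborel_integral_translate) simp
  have "\<bar>autocorr g v\<bar> \<le> (\<integral>x. \<bar>g (v + x) * g x\<bar> \<partial>lborel)"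
    unfolding autocorr_def by (rule integral_abs_bound)
  also have "\<dots> \<le> (\<integral>x. ((g (v + x))\<^sup>2 + (g x)\<^sup>2) / 2 \<partial>lborel)"
  proof (intro integral_mono integrable_abs integrable_autocorr_integrand)
    fix x show "\<bar>g (v + x) * g x\<bar> \<le> ((g (v + x))\<^sup>2 + (g x)\<^sup>2) / 2"
      using sum_squares_bound[of "\<bar>g (v + x)\<bar>" "\<bar>g x\<bar>"] by (simp add: abs_mult)
  qed (use L2 L2_translate in auto)
  also have "\<dots> = (\<integral>x. (g x)\<^sup>2 \<partial>lborel)"
    using L2 L2_translate[of v] eq by simp
  finally show ?thesis .
qed

text \<open>The signed square of \<open>g\<close> is integrable, so L^1 continuity of its translates
  squeezes the squared L^2 distance in \<open>autocorr_eq\<close> to 0.\<close>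

lemma autocorr_tendsto:
  assumes "h \<longlonglongrightarrow> 0"
  shows "(\<lambda>n. autocorr g (h n)) \<longlonglongrightarrow> (\<integral>x. (g x)\<^sup>2 \<partial>lborel)"
proof -
  let ?p = "\<lambda>x. g x * \<bar>g x\<bar>"
  have p: "integrable lborel ?p"
    by (rule Bochner_Integration.integrable_bound[OF L2]) (auto simp: abs_mult power2_eq_square)
  have lim: "(\<lambda>n. \<integral>x. (g (h n + x) - g x)\<^sup>2 \<partial>lborel) \<longlonglongrightarrow> 0"
  proof (rule tendsto_sandwich[OF _ _ tendsto_const])
    show "(\<lambda>n. 2 * (\<integral>x. \<bar>?p (h n + x) - ?p x\<bar> \<partial>lborel)) \<longlonglongrightarrow> 0"
      using tendsto_mult_right_zero[OF L1_translation_continuous[OF p assms]] .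
    have "integrable lborel (\<lambda>x. 2 * \<bar>?p (h n + x) - ?p x\<bar>)" for n
      using p lborel_integrable_translate[OF p] by simp
    then have "(\<integral>x. (g (h n + x) - g x)\<^sup>2 \<partial>lborel)
        \<le> (\<integral>x. 2 * \<bar>?p (h n + x) - ?p x\<bar> \<partial>lborel)" for n
      by (rule integral_mono') (auto intro: power2_diff_le_signed_squares)
    then show "\<forall>\<^sub>F n in sequentially. (\<integral>x. (g (h n + x) - g x)\<^sup>2 \<partial>lborel)
        \<le> 2 * (\<integral>x. \<bar>?p (h n + x) - ?p x\<bar> \<partial>lborel)" by simp
  qed simp
  show ?thesis unfolding autocorr_eq using tendsto_diff[OF tendsto_const tendsto_divide[OF lim tendsto_const[of 2]]] by simp
qed

lemma autocorr_measurable[measurable]: "autocorr g \<in> borel_measurable borel"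
proof -
  have "(\<lambda>v. \<integral>x. g (v + x) * g x \<partial>lborel) \<in> borel_measurable borel"
    by (rule lborel.borel_measurable_lebesgue_integral) simp
  then show ?thesis unfolding autocorr_def[abs_def] .
qed

text \<open>By Tonelli and translation invariance the integral of the modulus is the square of the
  L^1 norm of \<open>g\<close>.\<close>

lemma integrable_autocorr_pair: "integrable (lborel \<Otimes>\<^sub>M lborel) (\<lambda>(x, v). g (v + x) * g x)"
proof (rule lborel_pair.Fubini_integrable)
  have eq: "(\<integral>v. \<bar>g (v + x)\<bar> \<partial>lborel) = (\<integral>v. \<bar>g v\<bar> \<partial>lborel)" for x
    using lborel_integral_translate[of "\<lambda>v. \<bar>g v\<bar>" x] by (simp add: add.commute)
  show "integrable lborel (\<lambda>x. \<integral>v. norm (case (x, v) of (x, v) \<Rightarrow> g (v + x) * g x) \<partial>lborel)"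
    using L1 by (simp add: abs_mult eq)
  have "integrable lborel (\<lambda>v. g (v + x))" for x
    using lborel_integrable_translate[OF L1, of x] by (simp add: add.commute)
  then show "AE x in lborel. integrable lborel (\<lambda>v. case (x, v) of (x, v) \<Rightarrow> g (v + x) * g x)"
    by simp
qed simp

lemma integrable_autocorr: "integrable lborel (autocorr g)"
  using lborel_pair.integrable_snd[OF integrable_autocorr_pair] by (simp add: autocorr_def[abs_def])

text \<open>The shift \<open>x + v\<close> separates the variables of the double integral: one
  factor is the transform of \<open>g\<close>, the other its conjugate.\<close>

lemma norm_fourier_power2:
  "complex_of_real ((cmod (fourier g \<xi>))\<^sup>2) = fourier (autocorr g) \<xi>"
proof -
  let ?e = "\<lambda>x. cis (- (2 * pi) * (\<xi> \<bullet> x))"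
  note i = integrable_fourier_integrand[OF L1, of "- (2 * pi)" \<xi>]
  have tr: "(\<integral>v. (g (v + x) * g x) *\<^sub>R ?e v \<partial>lborel) = (g x *\<^sub>R cnj (?e x)) * fourier g \<xi>" for x
  proof -
    have "(\<integral>v. (g (v + x) * g x) *\<^sub>R ?e v \<partial>lborel)
        = (\<integral>v. (g x *\<^sub>R cnj (?e x)) * (g (x + v) *\<^sub>R ?e (x + v)) \<partial>lborel)"
    proof (intro Bochner_Integration.integral_cong refl)
      fix v
      have "cnj (?e x) * ?e (x + v) = ?e v"
        by (simp add: cis_cnj cis_mult inner_add_right algebra_simps)
      then show "(g (v + x) * g x) *\<^sub>R ?e v = (g x *\<^sub>R cnj (?e x)) * (g (x + v) *\<^sub>R ?e (x + v))"
        by (simp add: add.commute mult.commute)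
    qed
    also have "\<dots> = (g x *\<^sub>R cnj (?e x)) * (\<integral>v. g (x + v) *\<^sub>R ?e (x + v) \<partial>lborel)"
      by (rule Bochner_Integration.integral_mult_right) (rule lborel_integrable_translate[OF i])
    also have "(\<integral>v. g (x + v) *\<^sub>R ?e (x + v) \<partial>lborel) = fourier g \<xi>"
      unfolding fourier_def by (rule lborel_integral_translate) simp
    finally show ?thesis .
  qed
  \<comment> \<open>Characters have modulus 1, so the integrability of the autocorrelation kernel
    already permits Fubini.\<close>
  have int: "integrable (lborel \<Otimes>\<^sub>M lborel) (\<lambda>(x, v). (g (v + x) * g x) *\<^sub>R ?e v)"
    by (rule Bochner_Integration.integrable_bound[OF integrable_autocorr_pair]) auto
  have "fourier (autocorr g) \<xi> = (\<integral>v. \<integral>x. (g (v + x) * g x) *\<^sub>R ?e v \<partial>lborel \<partial>lborel)"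
    unfolding fourier_def autocorr_def by (simp add: integrable_autocorr_integrand)
  also have "\<dots> = (\<integral>x. \<integral>v. (g (v + x) * g x) *\<^sub>R ?e v \<partial>lborel \<partial>lborel)"
    by (rule lborel_pair.Fubini_integral) (rule int)
  also have "\<dots> = (\<integral>x. cnj (g x *\<^sub>R ?e x) \<partial>lborel) * fourier g \<xi>"
    unfolding tr using integrable_cnj[OF i] by (subst Bochner_Integration.integral_mult_left[symmetric]) auto
  also have "(\<integral>x. cnj (g x *\<^sub>R ?e x) \<partial>lborel) = cnj (fourier g \<xi>)"
    unfolding fourier_def by (rule Bochner_Integration.integral_cnj)
  finally show ?thesis by (simp add: complex_norm_square mult.commute del: of_real_power)
qed

end

section \<open>Plancherel by Gaussian summation\<close>

lemma
  fixes f :: "'a::euclidean_space \<Rightarrow> real \<Rightarrow> 'b::{real_normed_field, banach, second_countable_topology}"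
  assumes f: "\<And>b. b \<in> Basis \<Longrightarrow> integrable lborel (f b)"
  shows lborel_integrable_Basis_prod: "integrable lborel (\<lambda>x::'a. \<Prod>b\<in>Basis. f b (x \<bullet> b))"
    and lborel_integral_Basis_prod:
      "(\<integral>x. (\<Prod>b\<in>Basis. f b (x \<bullet> b)) \<partial>(lborel :: 'a measure)) = (\<Prod>b\<in>Basis. \<integral>t. f b t \<partial>lborel)"
proof -
  interpret product_sigma_finite "\<lambda>_::'a. lborel :: real measure" ..
  \<comment> \<open>\<open>lborel\<close> is the image of a product of one-dimensional measures
    under \<open>?T\<close>, which reassembles a vector from its coordinates.\<close>
  let ?T = "\<lambda>h::'a \<Rightarrow> real. \<Sum>b\<in>Basis. h b *\<^sub>R b"
  have T: "?T \<in> (\<Pi>\<^sub>M b\<in>Basis. lborel) \<rightarrow>\<^sub>M borel"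
  proof (intro borel_measurable_sum borel_measurable_scaleR borel_measurable_const)
    fix b :: 'a assume "b \<in> Basis"
    then have "(\<lambda>h. h b) \<in> (\<Pi>\<^sub>M b\<in>Basis. lborel :: real measure) \<rightarrow>\<^sub>M (lborel :: real measure)"
      by (rule measurable_component_singleton)
    then show "(\<lambda>h. h b) \<in> borel_measurable (\<Pi>\<^sub>M b\<in>Basis. lborel :: real measure)" by simp
  qed
  have [measurable]: "f b \<in> borel_measurable borel" if "b \<in> Basis" for b
    by (rule borel_measurable_lborel_integrable[OF f[OF that]])
  have m: "(\<lambda>x::'a. \<Prod>b\<in>Basis. f b (x \<bullet> b)) \<in> borel_measurable borel" by measurable
  have eq: "(\<Prod>b\<in>Basis. f b (?T h \<bullet> b)) = (\<Prod>b\<in>Basis. f b (h b))" for h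
    by (intro prod.cong) auto
  show "integrable lborel (\<lambda>x::'a. \<Prod>b\<in>Basis. f b (x \<bullet> b))"
    by (subst lborel_eq, subst integrable_distr_eq[OF T m], unfold eq)
      (intro product_integrable_prod f finite_Basis)
  show "(\<integral>x. (\<Prod>b\<in>Basis. f b (x \<bullet> b)) \<partial>(lborel :: 'a measure)) = (\<Prod>b\<in>Basis. \<integral>t. f b t \<partial>lborel)"
    by (subst lborel_eq, subst integral_distr[OF T m], unfold eq)
      (intro product_integral_prod f finite_Basis)
qed

lemma
  fixes f :: "'a::euclidean_space \<Rightarrow> 'b::{banach, second_countable_topology}"
  assumes f: "integrable lborel f" and c: "c \<noteq> 0"
  shows lborel_integrable_scale: "integrable lborel (\<lambda>x. f (c *\<^sub>R x))"
    and lborel_integral_scale: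
      "(\<integral>x. f x \<partial>lborel) = \<bar>c\<bar> ^ DIM('a) *\<^sub>R (\<integral>x. f (c *\<^sub>R x) \<partial>lborel)"
proof -
  have m[measurable]: "f \<in> borel_measurable borel" by (rule borel_measurable_lborel_integrable[OF f])
  have l: "(lborel :: 'a measure) = density (distr lborel borel ((*\<^sub>R) c)) (\<lambda>_. ennreal (\<bar>c\<bar> ^ DIM('a)))"
    using lborel_affine[OF c, of "0::'a"] by simp
  have "integrable (density (distr lborel borel ((*\<^sub>R) c)) (\<lambda>_. ennreal (\<bar>c\<bar> ^ DIM('a)))) f"
    using f l by simp
  then have "integrable lborel (\<lambda>x. \<bar>c\<bar> ^ DIM('a) *\<^sub>R f (c *\<^sub>R x))"
    by (subst (asm) integrable_density) (simp_all add: integrable_distr_eq)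
  from integrable_scaleR_right[OF this, of "inverse (\<bar>c\<bar> ^ DIM('a))"]
  show "integrable lborel (\<lambda>x. f (c *\<^sub>R x))"
    using c by simp
  show "(\<integral>x. f x \<partial>lborel) = \<bar>c\<bar> ^ DIM('a) *\<^sub>R (\<integral>x. f (c *\<^sub>R x) \<partial>lborel)"
    by (subst l, subst integral_density) (simp_all add: integral_distr)
qed

section \<open>The Gaussian and its Fourier transform\<close>

definition gauss :: "'a::euclidean_space \<Rightarrow> real" where
  "gauss x = (\<Prod>b\<in>Basis. std_normal_density (x \<bullet> b))"

lemma gauss_eq:
  "gauss (x::'a::euclidean_space) = exp (- (norm x)\<^sup>2 / 2) / sqrt (2 * pi) ^ DIM('a)"
proof -
  have "(norm x)\<^sup>2 = (\<Sum>b\<in>Basis. (x \<bullet> b)\<^sup>2)"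
    by (subst power2_norm_eq_inner, subst euclidean_inner) (simp add: power2_eq_square)
  then have "exp (- (norm x)\<^sup>2 / 2) = (\<Prod>b\<in>Basis. exp (- (x \<bullet> b)\<^sup>2 / 2))"
    by (simp add: sum_negf[symmetric] sum_divide_distrib exp_sum del: sum_negf)
  then show ?thesis
    by (simp add: gauss_def std_normal_density_def prod.distrib prod_dividef field_simps)
qed

lemma gauss_nonneg: "0 \<le> gauss x"
  by (simp add: gauss_eq)

lemma integrable_gauss: "integrable lborel (gauss :: 'a::euclidean_space \<Rightarrow> real)"
  unfolding gauss_def[abs_def]
  by (rule lborel_integrable_Basis_prod) simp

lemma gauss_measurable[measurable]: "gauss \<in> borel_measurable borel"
  by (rule borel_measurable_lborel_integrable[OF integrable_gauss])

lemma integral_gauss: "(\<integral>x. gauss (x::'a::euclidean_space) \<partial>lborel) = 1"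
  unfolding gauss_def by (subst lborel_integral_Basis_prod) simp_all

text \<open>The integrand factors over the coordinates, and each factor integrates to the
  characteristic function of the standard normal distribution.\<close>

lemma integral_gauss_cis:
  fixes y :: "'a::euclidean_space"
  shows "(\<integral>x. gauss x *\<^sub>R cis (y \<bullet> x) \<partial>lborel) = exp (- (norm y)\<^sup>2 / 2)"
proof -
  let ?f = "\<lambda>b t. std_normal_density t *\<^sub>R cis ((y \<bullet> b) * t)"
  have i: "integrable lborel (?f b)" for b :: 'a
    by (rule Bochner_Integration.integrable_bound[of lborel std_normal_density]) auto
  have one: "(\<integral>t. ?f b t \<partial>lborel) = complex_of_real (exp (- (y \<bullet> b)\<^sup>2 / 2))" for b :: 'a
  proof -
    have "(\<integral>t. ?f b t \<partial>lborel) = char std_normal_distribution (y \<bullet> b)"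
      unfolding char_def by (subst integral_density) (auto simp: cis_conv_exp)
    then show ?thesis unfolding char_std_normal_distribution by simp
  qed
  have cis_sum: "cis (sum h S) = (\<Prod>b\<in>S. cis (h b))" for h and S :: "'a set"
    by (induction S rule: infinite_finite_induct) (auto simp: cis_mult[symmetric])
  have "gauss x *\<^sub>R cis (y \<bullet> x) = (\<Prod>b\<in>Basis. ?f b (x \<bullet> b))" for x :: 'a
    by (subst euclidean_inner[of y x], subst cis_sum)
      (simp add: gauss_def scaleR_conv_of_real prod.distrib)
  then have "(\<integral>x. gauss x *\<^sub>R cis (y \<bullet> x) \<partial>lborel) = (\<Prod>b\<in>Basis. \<integral>t. ?f b t \<partial>lborel)"
    using lborel_integral_Basis_prod[of ?f, OF i] by simp
  also have "\<dots> = complex_of_real (\<Prod>b\<in>Basis. exp (- (y \<bullet> b)\<^sup>2 / 2))" unfolding one by simp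
  also have "(\<Prod>b\<in>Basis. exp (- (y \<bullet> b)\<^sup>2 / 2)) = exp (\<Sum>b\<in>Basis. - (y \<bullet> b)\<^sup>2 / 2)"
    by (simp add: exp_sum)
  also have "(\<Sum>b\<in>Basis. - (y \<bullet> b)\<^sup>2 / 2) = - (norm y)\<^sup>2 / 2"
    by (subst power2_norm_eq_inner, subst euclidean_inner)
      (simp add: power2_eq_square sum_negf sum_divide_distrib)
  finally show ?thesis .
qed

text \<open>This is \<open>exp (- 2 * pi\<^sup>2 * (norm \<xi>)\<^sup>2)\<close>, the transform of
  \<open>gauss\<close>; its own transform is \<open>gauss\<close> again.\<close>

definition gauss_weight :: "'a::euclidean_space \<Rightarrow> real" where
  "gauss_weight \<xi> = exp (- (norm ((2 * pi) *\<^sub>R \<xi>))\<^sup>2 / 2)"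

lemma gauss_weight_nonneg [simp]: "0 \<le> gauss_weight \<xi>"
  by (simp add: gauss_weight_def)

text \<open>The weights grow as the scale shrinks, which is what monotone convergence in
  \<open>plancherel\<close> asks for.\<close>

lemma gauss_weight_scale_mono:
  assumes "0 \<le> t" "t \<le> s"
  shows "gauss_weight (s *\<^sub>R \<xi>) \<le> gauss_weight (t *\<^sub>R \<xi>)"
proof -
  have "norm ((2 * pi) *\<^sub>R t *\<^sub>R \<xi>) \<le> norm ((2 * pi) *\<^sub>R s *\<^sub>R \<xi>)"
    using assms by (simp add: mult_right_mono)
  then show ?thesis
    unfolding gauss_weight_def by (simp add: power_mono del: norm_scaleR)
qed

lemma gauss_weight_tendsto:
  assumes "s \<longlonglongrightarrow> 0"
  shows "(\<lambda>n. gauss_weight (s n *\<^sub>R \<xi>)) \<longlonglongrightarrow> 1"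
proof -
  have "(\<lambda>n. gauss_weight (s n *\<^sub>R \<xi>)) \<longlonglongrightarrow> exp (- (norm ((2 * pi) *\<^sub>R (0::real) *\<^sub>R \<xi>))\<^sup>2 / 2)"
    unfolding gauss_weight_def by (intro tendsto_intros assms) simp
  then show ?thesis by simp
qed

lemma gauss_weight_eq:
  "gauss_weight (\<xi>::'a::euclidean_space) = sqrt (2 * pi) ^ DIM('a) * gauss ((2 * pi) *\<^sub>R \<xi>)"
  by (simp add: gauss_eq gauss_weight_def)

lemma integrable_gauss_weight: "integrable lborel (gauss_weight :: 'a::euclidean_space \<Rightarrow> real)"
  unfolding gauss_weight_eq[abs_def]
  by (intro integrable_mult_right lborel_integrable_scale integrable_gauss) simp

lemma gauss_weight_measurable[measurable]: "gauss_weight \<in> borel_measurable borel"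
  by (rule borel_measurable_lborel_integrable[OF integrable_gauss_weight])

text \<open>The weight is a multiple of a dilated Gaussian, so undoing the dilation reduces its
  transform to \<open>integral_gauss_cis\<close>; the computation is explicit and rests on no
  inversion theorem.\<close>

lemma gauss_eq_fourier_weight: "complex_of_real (gauss (z::'a::euclidean_space)) = fourier gauss_weight z"
proof -
  let ?c = "sqrt (2 * pi) ^ DIM('a)"
  \<comment> \<open>One factor \<open>?c\<close> comes from \<open>gauss_weight_eq\<close>, the
    other from the normalisation of \<open>gauss\<close>; their product is the Jacobian of the
    dilation by \<open>2 * pi\<close>.\<close>
  have c2: "?c * ?c = (2 * pi) ^ DIM('a)"
    by (simp only: power_mult_distrib[symmetric]) simp
  have "fourier gauss_weight z
      = (\<integral>x. ?c *\<^sub>R (gauss ((2 * pi) *\<^sub>R x) *\<^sub>R cis ((- z) \<bullet> ((2 * pi) *\<^sub>R x))) \<partial>lborel)"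
    unfolding fourier_def gauss_weight_eq by (intro Bochner_Integration.integral_cong) auto
  also have "\<dots> = ?c *\<^sub>R (\<integral>x. gauss ((2 * pi) *\<^sub>R x) *\<^sub>R cis ((- z) \<bullet> ((2 * pi) *\<^sub>R x)) \<partial>lborel)"
    by (rule Bochner_Integration.integral_scaleR_right)
  finally have 1: "fourier gauss_weight z = \<dots>" .
  have "integrable lborel (\<lambda>x. gauss x *\<^sub>R cis ((- z) \<bullet> x))"
    using integrable_fourier_integrand[OF integrable_gauss, of "-1" z] by simp
  from lborel_integral_scale[OF this, of "2 * pi"]
  have "complex_of_real (exp (- (norm z)\<^sup>2 / 2))
      = (2 * pi) ^ DIM('a) *\<^sub>R (\<integral>x. gauss ((2 * pi) *\<^sub>R x) *\<^sub>R cis ((- z) \<bullet> ((2 * pi) *\<^sub>R x)) \<partial>lborel)"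
    unfolding integral_gauss_cis by simp
  also have "\<dots> = ?c *\<^sub>R fourier gauss_weight z" unfolding 1 c2[symmetric] by simp
  finally show ?thesis
    by (simp add: gauss_eq scaleR_conv_of_real field_simps)
qed

section \<open>Multiplication formula and Plancherel identity\<close>

lemma fourier_scale:
  fixes g :: "'a::euclidean_space \<Rightarrow> real"
  assumes g: "integrable lborel g" and s: "s > 0"
  shows "fourier (\<lambda>z. g (s *\<^sub>R z)) (s *\<^sub>R \<xi>) = fourier g \<xi> /\<^sub>R s ^ DIM('a)"
proof -
  note lborel_integral_scale[OF integrable_fourier_integrand[OF g, of "- (2 * pi)" \<xi>], of s]
  then show ?thesis using s by (simp add: fourier_def)
qed

text \<open>The kernel is symmetric and of modulus 1, so Fubini exchanges the roles of
  \<open>f\<close> and \<open>g\<close>.\<close>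

lemma fourier_multiplication:
  fixes f g :: "'a::euclidean_space \<Rightarrow> real"
  assumes f: "integrable lborel f" and g: "integrable lborel g"
  shows "(\<integral>x. f x *\<^sub>R fourier g x \<partial>lborel) = (\<integral>x. g x *\<^sub>R fourier f x \<partial>lborel)"
proof -
  have [measurable]: "f \<in> borel_measurable borel" "g \<in> borel_measurable borel"
    using f g by (auto dest: borel_measurable_integrable)
  let ?F = "\<lambda>x y. (f x * g y) *\<^sub>R cis (- (2 * pi) * (x \<bullet> y))"
  have int: "integrable (lborel \<Otimes>\<^sub>M lborel) (\<lambda>(x, y). ?F x y)"
  proof (rule lborel_pair.Fubini_integrable)
    show "integrable lborel (\<lambda>x. \<integral>y. norm (case (x, y) of (x, y) \<Rightarrow> ?F x y) \<partial>lborel)"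
      using f g by (simp add: abs_mult)
    show "AE x in lborel. integrable lborel (\<lambda>y. case (x, y) of (x, y) \<Rightarrow> ?F x y)"
      unfolding scaleR_scaleR[symmetric] prod.case
      by (intro AE_I2 integrable_scaleR_right integrable_fourier_integrand g)
  qed simp
  have "(\<integral>x. f x *\<^sub>R fourier g x \<partial>lborel) = (\<integral>x. \<integral>y. ?F x y \<partial>lborel \<partial>lborel)"
    unfolding fourier_def by (simp add: scaleR_scaleR[symmetric] del: scaleR_scaleR)
  also have "\<dots> = (\<integral>y. \<integral>x. ?F x y \<partial>lborel \<partial>lborel)"
    by (rule lborel_pair.Fubini_integral[OF int, symmetric])
  also have "\<dots> = (\<integral>y. \<integral>x. g y *\<^sub>R (f x *\<^sub>R cis (- (2 * pi) * (y \<bullet> x))) \<partial>lborel \<partial>lborel)"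
    by (simp add: inner_commute mult.commute)
  also have "\<dots> = (\<integral>y. g y *\<^sub>R fourier f y \<partial>lborel)"
    unfolding fourier_def scaleR_scaleR[symmetric] Bochner_Integration.integral_scaleR_right ..
  finally show ?thesis .
qed

lemma norm_fourier_le:
  assumes "integrable lborel f"
  shows "norm (fourier f \<xi>) \<le> (\<integral>x. \<bar>f x\<bar> \<partial>lborel)"
  unfolding fourier_def by (rule order_trans[OF integral_norm_bound]) simp

context
  fixes g :: "'a::euclidean_space \<Rightarrow> real"
  assumes L1: "integrable lborel g" and L2: "integrable lborel (\<lambda>x. (g x)\<^sup>2)"
begin

lemmas [measurable] = borel_measurable_lborel_integrable[OF L1] autocorr_measurable[OF L1 L2]

text \<open>Square integrability of the transform is not known yet; its bound by the L^1 norm of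
  \<open>g\<close> together with the Gaussian factor suffices here.\<close>

lemma integrable_fourier_weight:
  assumes s: "s > 0"
  shows "integrable lborel (\<lambda>\<xi>. gauss_weight (s *\<^sub>R \<xi>) * (cmod (fourier g \<xi>))\<^sup>2)"
proof (rule Bochner_Integration.integrable_bound)
  show "integrable lborel (\<lambda>\<xi>::'a. gauss_weight (s *\<^sub>R \<xi>) * (\<integral>x. \<bar>g x\<bar> \<partial>lborel)\<^sup>2)"
    by (intro integrable_mult_left lborel_integrable_scale integrable_gauss_weight) (use s in simp)
  have "(cmod (fourier g \<xi>))\<^sup>2 \<le> (\<integral>x. \<bar>g x\<bar> \<partial>lborel)\<^sup>2" for \<xi>
    by (intro power_mono norm_fourier_le L1) simp
  then show "AE \<xi> in lborel. norm (gauss_weight (s *\<^sub>R \<xi>) * (cmod (fourier g \<xi>))\<^sup>2)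
      \<le> norm (gauss_weight (s *\<^sub>R \<xi>) * (\<integral>x. \<bar>g x\<bar> \<partial>lborel)\<^sup>2)"
    by (intro AE_I2) (simp add: abs_mult mult_left_mono)
qed simp

text \<open>Since \<open>gauss\<close> is the transform of the weight, the multiplication formula
  moves the transform onto the dilated autocorrelation, where \<open>norm_fourier_power2\<close>
  applies. The right-hand side averages the autocorrelation at scale \<open>s\<close>.\<close>

lemma integral_fourier_weight:
  assumes s: "s > 0"
  shows "(\<integral>\<xi>. gauss_weight (s *\<^sub>R \<xi>) * (cmod (fourier g \<xi>))\<^sup>2 \<partial>lborel)
       = (\<integral>z. autocorr g (s *\<^sub>R z) * gauss z \<partial>lborel)"
proof -
  let ?A = "\<lambda>z. autocorr g (s *\<^sub>R z)"
  note iA = integrable_autocorr[OF L1 L2]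
  have iAs: "integrable lborel ?A" using lborel_integrable_scale[OF iA, of s] s by simp
  have i: "integrable lborel (\<lambda>\<xi>. gauss_weight \<xi> *\<^sub>R fourier ?A \<xi>)"
  proof (rule Bochner_Integration.integrable_bound)
    show "integrable lborel (\<lambda>\<xi>::'a. gauss_weight \<xi> * (\<integral>x. \<bar>?A x\<bar> \<partial>lborel))"
      by (intro integrable_mult_left integrable_gauss_weight)
    show "AE \<xi> in lborel. norm (gauss_weight \<xi> *\<^sub>R fourier ?A \<xi>)
        \<le> norm (gauss_weight \<xi> * (\<integral>x. \<bar>?A x\<bar> \<partial>lborel))"
      using norm_fourier_le[OF iAs] by (intro AE_I2) (simp add: abs_mult mult_left_mono)
  qed simp
  have "complex_of_real (\<integral>z. ?A z * gauss z \<partial>lborel) = (\<integral>z. ?A z *\<^sub>R fourier gauss_weight z \<partial>lborel)"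
    unfolding gauss_eq_fourier_weight[symmetric] scaleR_conv_of_real of_real_mult[symmetric]
    by (rule integral_complex_of_real[symmetric])
  also have "\<dots> = (\<integral>\<xi>. gauss_weight \<xi> *\<^sub>R fourier ?A \<xi> \<partial>lborel)"
    by (rule fourier_multiplication[OF iAs integrable_gauss_weight])
  \<comment> \<open>The substitution produces a power of \<open>s\<close> as Jacobian, which the
    next step cancels by \<open>fourier_scale\<close>.\<close>
  also have "\<dots> = s ^ DIM('a) *\<^sub>R (\<integral>\<xi>. gauss_weight (s *\<^sub>R \<xi>) *\<^sub>R fourier ?A (s *\<^sub>R \<xi>) \<partial>lborel)"
    using lborel_integral_scale[OF i, of s] s by simp
  also have "\<dots> = (\<integral>\<xi>. gauss_weight (s *\<^sub>R \<xi>) *\<^sub>R fourier (autocorr g) \<xi> \<partial>lborel)"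
    unfolding fourier_scale[OF iA s] using s
    by (subst Bochner_Integration.integral_scaleR_right[symmetric], intro Bochner_Integration.integral_cong)
      (auto simp: field_simps)
  also have "\<dots> = complex_of_real (\<integral>\<xi>. gauss_weight (s *\<^sub>R \<xi>) * (cmod (fourier g \<xi>))\<^sup>2 \<partial>lborel)"
    unfolding norm_fourier_power2[OF L1 L2, symmetric] scaleR_conv_of_real of_real_mult[symmetric]
    by (rule integral_complex_of_real)
  finally show ?thesis by (simp only: of_real_eq_iff)
qed

text \<open>Monotone convergence on the frequency side asks for no prior finiteness, hence the
  extended nonnegative integral. On the other side dominated convergence uses
  \<open>abs_autocorr_le\<close>, and \<open>gauss\<close> has total mass 1.\<close>

theorem plancherel: "(\<integral>\<^sup>+\<xi>. (cmod (fourier g \<xi>))\<^sup>2 \<partial>lborel) = (\<integral>x. (g x)\<^sup>2 \<partial>lborel)"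
proof (rule LIMSEQ_unique)
  let ?s = "\<lambda>n. 1 / real (Suc n)"
  let ?f = "\<lambda>n \<xi>. gauss_weight (?s n *\<^sub>R \<xi>) * (cmod (fourier g \<xi>))\<^sup>2"
  have s0: "?s \<longlonglongrightarrow> 0" by (rule LIMSEQ_Suc[OF lim_1_over_n])
  show "(\<lambda>n. \<integral>\<^sup>+\<xi>. ?f n \<xi> \<partial>lborel) \<longlonglongrightarrow> (\<integral>\<^sup>+\<xi>. (cmod (fourier g \<xi>))\<^sup>2 \<partial>lborel)"
  proof (rule nn_integral_LIMSEQ)
    have "?f m \<xi> \<le> ?f n \<xi>" if "m \<le> n" for m n \<xi>
      using that by (intro mult_right_mono gauss_weight_scale_mono) (auto simp: frac_le)
    then show "incseq (\<lambda>n \<xi>. ennreal (?f n \<xi>))"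
      by (auto simp: incseq_def le_fun_def intro!: ennreal_leI)
    show "(\<lambda>n. ennreal (?f n \<xi>)) \<longlonglongrightarrow> ennreal ((cmod (fourier g \<xi>))\<^sup>2)" for \<xi>
      using tendsto_mult_right[OF gauss_weight_tendsto[OF s0, of \<xi>], of "(cmod (fourier g \<xi>))\<^sup>2"]
      by (intro tendsto_ennrealI) simp
  qed simp
  have eq: "(\<integral>\<^sup>+\<xi>. ?f n \<xi> \<partial>lborel) = ennreal (\<integral>z. autocorr g (?s n *\<^sub>R z) * gauss z \<partial>lborel)" for n
    by (subst integral_fourier_weight[symmetric], simp)
      (intro nn_integral_eq_integral integrable_fourier_weight, auto)
  have "(\<lambda>n. \<integral>z. autocorr g (?s n *\<^sub>R z) * gauss z \<partial>lborel)
      \<longlonglongrightarrow> (\<integral>z. (\<integral>x. (g x)\<^sup>2 \<partial>lborel) * gauss (z::'a) \<partial>lborel)"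
  proof (rule integral_dominated_convergence[where w = "\<lambda>z. (\<integral>x. (g x)\<^sup>2 \<partial>lborel) * gauss z"])
    show "AE z in lborel. (\<lambda>n. autocorr g (?s n *\<^sub>R z) * gauss z)
        \<longlonglongrightarrow> (\<integral>x. (g x)\<^sup>2 \<partial>lborel) * gauss z"
      by (intro AE_I2 tendsto_mult_right autocorr_tendsto[OF L1 L2])
        (rule tendsto_eq_intros s0 refl | simp)+
    show "AE z in lborel. norm (autocorr g (?s n *\<^sub>R z) * gauss z)
        \<le> (\<integral>x. (g x)\<^sup>2 \<partial>lborel) * gauss z" for n
      using abs_autocorr_le[OF L1 L2] by (auto simp: abs_mult gauss_nonneg intro!: mult_right_mono)
  qed (use integrable_gauss in auto)
  then show "(\<lambda>n. \<integral>\<^sup>+\<xi>. ?f n \<xi> \<partial>lborel) \<longlonglongrightarrow> ennreal (\<integral>x. (g x)\<^sup>2 \<partial>lborel)"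
    unfolding eq by (intro tendsto_ennrealI) (simp add: integral_gauss)
qed

end

section \<open>Derivatives under the Fourier transform\<close>

text \<open>The derivative need not be locally integrable, but if it is not, the right-hand side is infinite.\<close>

lemma ftc_square_bound:
  fixes \<phi> \<phi>' :: "real \<Rightarrow> real"
  assumes d: "\<And>s. (\<phi> has_real_derivative \<phi>' s) (at s)"
    and m[measurable]: "\<phi>' \<in> borel_measurable borel" and h: "h > 0"
  shows "ennreal ((\<phi> h - \<phi> 0)\<^sup>2)
       \<le> ennreal h * (\<integral>\<^sup>+s. indicator {0..h} s * ennreal ((\<phi>' s)\<^sup>2) \<partial>lborel)"
proof (cases "(\<integral>\<^sup>+s. indicator {0..h} s * ennreal ((\<phi>' s)\<^sup>2) \<partial>lborel) = \<infinity>")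
  case True
  then show ?thesis using h by (simp add: ennreal_mult_top)
next
  case False
  let ?I = "\<integral>\<^sup>+s. indicator {0..h} s * ennreal ((\<phi>' s)\<^sup>2) \<partial>lborel"
  let ?J = "\<integral>\<^sup>+s. ennreal \<bar>indicator {0..h} s *\<^sub>R \<phi>' s\<bar> \<partial>lborel"
  \<comment> \<open>Cauchy-Schwarz against the indicator of \<open>{0..h}\<close>, whose square has
    integral \<open>h\<close>, makes the derivative absolutely integrable on this interval.\<close>
  have "?J\<^sup>2 = (\<integral>\<^sup>+s. ennreal \<bar>indicator {0..h} s *\<^sub>R \<phi>' s\<bar> * indicator {0..h} s \<partial>lborel)\<^sup>2"
    by (intro arg_cong[where f = "\<lambda>x. x\<^sup>2"] nn_integral_cong) (auto simp: indicator_def)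
  also have "\<dots> \<le> (\<integral>\<^sup>+s. (ennreal \<bar>indicator {0..h} s *\<^sub>R \<phi>' s\<bar>)\<^sup>2 \<partial>lborel)
      * (\<integral>\<^sup>+s. (indicator {0..h} s)\<^sup>2 \<partial>(lborel :: real measure))"
    by (rule Cauchy_Schwarz_nn_integral) simp_all
  also have "(\<integral>\<^sup>+s. (ennreal \<bar>indicator {0..h} s *\<^sub>R \<phi>' s\<bar>)\<^sup>2 \<partial>lborel) = ?I"
    by (intro nn_integral_cong) (auto simp: indicator_def ennreal_power)
  also have "(\<integral>\<^sup>+s. (indicator {0..h} s)\<^sup>2 \<partial>(lborel :: real measure)) = (\<integral>\<^sup>+s. indicator {0..h} s \<partial>lborel)"
    by (intro nn_integral_cong) (auto simp: indicator_def)
  also have "\<dots> = ennreal h" using h by simp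
  finally have J: "?J\<^sup>2 \<le> ennreal h * ?I" by (simp add: mult.commute)
  also have "\<dots> < \<infinity>" using False by (simp add: ennreal_mult_less_top less_top)
  finally have fin: "?J < \<infinity>" by (auto simp: power2_eq_square less_top[symmetric])
  have int: "integrable lborel (\<lambda>s. indicator {0..h} s *\<^sub>R \<phi>' s)"
    using fin by (intro integrableI_bounded) simp_all
  have "((\<lambda>s. indicator {0..h} s *\<^sub>R \<phi>' s) has_integral (\<integral>s. indicator {0..h} s *\<^sub>R \<phi>' s \<partial>lborel)) UNIV"
    using int by (rule has_integral_integral_lborel)
  moreover have "(\<lambda>s. indicator {0..h} s *\<^sub>R \<phi>' s) = (\<lambda>s. if s \<in> {0..h} then \<phi>' s else 0)"
    by (auto simp: indicator_def)
  ultimately have "(\<phi>' has_integral (\<integral>s. indicator {0..h} s *\<^sub>R \<phi>' s \<partial>lborel)) {0..h}"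
    by (simp only: has_integral_restrict_UNIV)
  \<comment> \<open>The fundamental theorem yields a Henstock-Kurzweil integral; uniqueness
    identifies it with the Lebesgue integral, which exists because \<open>?J\<close> is
    finite.\<close>
  moreover have "(\<phi>' has_integral (\<phi> h - \<phi> 0)) {0..h}"
    using h d by (intro fundamental_theorem_of_calculus)
      (auto simp: has_real_derivative_iff_has_vector_derivative intro: has_vector_derivative_at_within)
  ultimately have eq: "\<phi> h - \<phi> 0 = (\<integral>s. indicator {0..h} s *\<^sub>R \<phi>' s \<partial>lborel)"
    by (rule has_integral_unique[symmetric])
  have "ennreal \<bar>\<phi> h - \<phi> 0\<bar> \<le> ?J"
    using integral_norm_bound_ennreal[OF int] unfolding eq by simp
  then have "(ennreal \<bar>\<phi> h - \<phi> 0\<bar>)\<^sup>2 \<le> ?J\<^sup>2" by (rule power_mono) simp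
  also note J
  finally show ?thesis by (simp add: ennreal_power)
qed

text \<open>Integrate \<open>ftc_square_bound\<close> over all base points. After Tonelli the
  integral of the shifted squared derivative does not depend on \<open>s\<close>, by translation
  invariance, so averaging over \<open>{0..h}\<close> returns it unchanged.\<close>

lemma difference_quotient_L2_bound:
  fixes g g' :: "'a::euclidean_space \<Rightarrow> real" and v :: 'a
  assumes d: "\<And>x. ((\<lambda>t. g (x + t *\<^sub>R v)) has_real_derivative g' x) (at 0)"
    and m[measurable]: "g' \<in> borel_measurable borel" and [measurable]: "g \<in> borel_measurable borel"
    and h: "h > 0"
  shows "(\<integral>\<^sup>+x. ennreal (((g (x + h *\<^sub>R v) - g x) / h)\<^sup>2) \<partial>lborel) \<le> (\<integral>\<^sup>+x. ennreal ((g' x)\<^sup>2) \<partial>lborel)"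
proof -
  let ?G = "\<integral>\<^sup>+x. ennreal ((g' x)\<^sup>2) \<partial>lborel"
  let ?k = "\<lambda>x s. indicator {0..h} s * ennreal ((g' (x + s *\<^sub>R v))\<^sup>2)"
  have pt: "ennreal (((g (x + h *\<^sub>R v) - g x) / h)\<^sup>2)
      \<le> ennreal (1 / h) * (\<integral>\<^sup>+s. ?k x s \<partial>lborel)" for x
  proof -
    \<comment> \<open>The hypothesis differentiates each line at parameter 0 only; the base point
      \<open>x + s *\<^sub>R v\<close> gives the other parameters.\<close>
    have "((\<lambda>t. g (x + t *\<^sub>R v)) has_real_derivative g' (x + s *\<^sub>R v)) (at s)" for s
      using d[of "x + s *\<^sub>R v"] DERIV_shift[of "\<lambda>t. g (x + t *\<^sub>R v)" "g' (x + s *\<^sub>R v)" 0 s]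
      by (simp add: algebra_simps)
    from ftc_square_bound[OF this _ h]
    have "ennreal ((g (x + h *\<^sub>R v) - g x)\<^sup>2) \<le> ennreal h * (\<integral>\<^sup>+s. ?k x s \<partial>lborel)" by simp
    then have "ennreal (1 / h\<^sup>2) * ennreal ((g (x + h *\<^sub>R v) - g x)\<^sup>2)
        \<le> ennreal (1 / h\<^sup>2) * (ennreal h * (\<integral>\<^sup>+s. ?k x s \<partial>lborel))"
      by (rule mult_left_mono) simp
    moreover have "ennreal (1 / h\<^sup>2) * ennreal h = ennreal (1 / h)"
      using h by (simp add: ennreal_mult[symmetric] power2_eq_square)
    ultimately show ?thesis
      by (simp add: mult.assoc[symmetric] ennreal_mult[symmetric] power_divide)
  qed
  have "(\<integral>\<^sup>+x. ennreal (((g (x + h *\<^sub>R v) - g x) / h)\<^sup>2) \<partial>lborel)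
      \<le> (\<integral>\<^sup>+x. ennreal (1 / h) * (\<integral>\<^sup>+s. ?k x s \<partial>lborel) \<partial>lborel)"
    by (rule nn_integral_mono) (rule pt)
  also have "\<dots> = ennreal (1 / h) * (\<integral>\<^sup>+x. \<integral>\<^sup>+s. ?k x s \<partial>lborel \<partial>lborel)"
    by (rule nn_integral_cmult) measurable
  also have "(\<integral>\<^sup>+x. \<integral>\<^sup>+s. ?k x s \<partial>lborel \<partial>lborel) = (\<integral>\<^sup>+s. \<integral>\<^sup>+x. ?k x s \<partial>lborel \<partial>lborel)"
    by (rule lborel_pair.Fubini'[symmetric]) measurable
  also have "\<dots> = (\<integral>\<^sup>+s. indicator {0..h} s * ?G \<partial>lborel)"
  proof (rule nn_integral_cong)
    fix s
    have "(\<integral>\<^sup>+x. ?k x s \<partial>lborel) = indicator {0..h} s * (\<integral>\<^sup>+x. ennreal ((g' (x + s *\<^sub>R v))\<^sup>2) \<partial>lborel)"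
      by (rule nn_integral_cmult) measurable
    also have "(\<integral>\<^sup>+x. ennreal ((g' (x + s *\<^sub>R v))\<^sup>2) \<partial>lborel) = ?G"
      using nn_integral_lborel_translate[of "\<lambda>x. ennreal ((g' x)\<^sup>2)" "s *\<^sub>R v"] by (simp add: add.commute)
    finally show "(\<integral>\<^sup>+x. ?k x s \<partial>lborel) = indicator {0..h} s * ?G" .
  qed
  also have "\<dots> = ennreal h * ?G" using h by (simp add: nn_integral_multc)
  also have "ennreal (1 / h) * (ennreal h * ?G) = ?G"
    using h by (simp add: mult.assoc[symmetric] ennreal_mult[symmetric])
  finally show ?thesis .
qed

section \<open>Translations and difference quotients as Fourier multipliers\<close>

lemma fourier_translate:
  fixes g :: "'a::euclidean_space \<Rightarrow> real"
  assumes g: "integrable lborel g"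
  shows "fourier (\<lambda>x. g (v + x)) \<xi> = cis (2 * pi * (\<xi> \<bullet> v)) * fourier g \<xi>"
proof -
  let ?e = "\<lambda>x. cis (- (2 * pi) * (\<xi> \<bullet> x))"
  have [measurable]: "g \<in> borel_measurable borel" by (rule borel_measurable_lborel_integrable[OF g])
  have "fourier (\<lambda>x. g (v + x)) \<xi> = (\<integral>x. cis (2 * pi * (\<xi> \<bullet> v)) * (g (v + x) *\<^sub>R ?e (v + x)) \<partial>lborel)"
    unfolding fourier_def
  proof (intro Bochner_Integration.integral_cong refl)
    fix x
    have "?e x = cis (2 * pi * (\<xi> \<bullet> v)) * ?e (v + x)"
      by (simp add: cis_mult inner_add_right algebra_simps)
    then show "g (v + x) *\<^sub>R ?e x = cis (2 * pi * (\<xi> \<bullet> v)) * (g (v + x) *\<^sub>R ?e (v + x))" by simp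
  qed
  also have "\<dots> = cis (2 * pi * (\<xi> \<bullet> v)) * (\<integral>x. g (v + x) *\<^sub>R ?e (v + x) \<partial>lborel)"
    by (rule Bochner_Integration.integral_mult_right)
      (rule lborel_integrable_translate[OF integrable_fourier_integrand[OF g]])
  also have "(\<integral>x. g (v + x) *\<^sub>R ?e (v + x) \<partial>lborel) = fourier g \<xi>"
    unfolding fourier_def by (rule lborel_integral_translate) simp
  finally show ?thesis .
qed

text \<open>Translation multiplies the transform by a character, and \<open>cis (2 * t) - 1\<close>
  has modulus \<open>2 * \<bar>sin t\<bar>\<close>, here with
  \<open>t = h * (pi * (\<xi> \<bullet> v))\<close>.\<close>

lemma fourier_difference_quotient:
  fixes g :: "'a::euclidean_space \<Rightarrow> real"
  assumes g: "integrable lborel g" and h: "h \<noteq> 0"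
  shows "(cmod (fourier (\<lambda>x. (g (x + h *\<^sub>R v) - g x) / h) \<xi>))\<^sup>2
       = (2 * sin (h * (pi * (\<xi> \<bullet> v))) / h)\<^sup>2 * (cmod (fourier g \<xi>))\<^sup>2"
proof -
  let ?a = "pi * (\<xi> \<bullet> v)"
  note gt = lborel_integrable_translate[OF g, of "h *\<^sub>R v"]
  have "fourier (\<lambda>x. (g (x + h *\<^sub>R v) - g x) / h) \<xi>
      = (\<integral>x. (1 / h) *\<^sub>R (g (h *\<^sub>R v + x) *\<^sub>R cis (- (2 * pi) * (\<xi> \<bullet> x)) - g x *\<^sub>R cis (- (2 * pi) * (\<xi> \<bullet> x))) \<partial>lborel)"
    unfolding fourier_def
    by (intro Bochner_Integration.integral_cong) (auto simp: add.commute algebra_simps diff_divide_distrib)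
  also have "\<dots> = (1 / h) *\<^sub>R (fourier (\<lambda>x. g (h *\<^sub>R v + x)) \<xi> - fourier g \<xi>)"
    unfolding fourier_def
    by (subst Bochner_Integration.integral_scaleR_right, subst Bochner_Integration.integral_diff)
      (rule refl integrable_fourier_integrand g gt)+
  also have "\<dots> = (1 / h) *\<^sub>R ((cis (2 * (h * ?a)) - 1) * fourier g \<xi>)"
    unfolding fourier_translate[OF g] by (simp add: algebra_simps)
  finally have "(cmod (fourier (\<lambda>x. (g (x + h *\<^sub>R v) - g x) / h) \<xi>))\<^sup>2
      = (1 / h)\<^sup>2 * (cmod (cis (2 * (h * ?a)) - 1))\<^sup>2 * (cmod (fourier g \<xi>))\<^sup>2"
    by (simp add: norm_mult power_mult_distrib power_divide)
  also have "(cmod (cis (2 * t) - 1))\<^sup>2 = (2 * sin t)\<^sup>2" for t :: real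
  proof -
    have "(cmod (cis (2 * t) - 1))\<^sup>2 = (cos (2 * t) - 1)\<^sup>2 + (sin (2 * t))\<^sup>2"
      by (simp add: cmod_power2)
    also have "\<dots> = (2 * (sin t)\<^sup>2)\<^sup>2 + (2 * sin t * cos t)\<^sup>2"
      by (simp add: cos_double_sin sin_double)
    also have "\<dots> = (2 * sin t)\<^sup>2 * ((sin t)\<^sup>2 + (cos t)\<^sup>2)"
      by algebra
    finally show ?thesis by simp
  qed
  finally show ?thesis by (simp add: power_divide)
qed

text \<open>The terms are difference quotients of \<open>\<lambda>t. 2 * sin (t * a)\<close> at
  0.\<close>

lemma sin_scaled_tendsto:
  fixes a :: real
  assumes "h \<longlonglongrightarrow> 0" "\<And>n. h n \<noteq> 0"
  shows "(\<lambda>n. (2 * sin (h n * a) / h n)) \<longlonglongrightarrow> 2 * a"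
proof -
  have "((\<lambda>t. 2 * sin (t * a)) has_real_derivative 2 * a) (at 0)"
    by (auto intro!: derivative_eq_intros)
  then have "((\<lambda>t. 2 * sin (t * a) / t) \<longlongrightarrow> 2 * a) (at 0)"
    by (simp add: DERIV_def)
  moreover have "filterlim h (at 0) sequentially"
    using assms by (simp add: filterlim_at)
  ultimately show ?thesis by (rule filterlim_compose)
qed

text \<open>An identity in the extended nonnegative reals: both sides are finite together or
  infinite together, so Fatou gives both inequalities without a case distinction.\<close>

theorem plancherel_derivative:
  fixes g g' :: "'a::euclidean_space \<Rightarrow> real" and v :: 'a
  assumes L1: "integrable lborel g" and L2: "integrable lborel (\<lambda>x. (g x)\<^sup>2)"
    and d: "\<And>x. ((\<lambda>t. g (x + t *\<^sub>R v)) has_real_derivative g' x) (at 0)"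
    and m[measurable]: "g' \<in> borel_measurable borel"
  shows "(\<integral>\<^sup>+\<xi>. ennreal ((2 * pi * (\<xi> \<bullet> v))\<^sup>2 * (cmod (fourier g \<xi>))\<^sup>2) \<partial>lborel)
       = (\<integral>\<^sup>+x. ennreal ((g' x)\<^sup>2) \<partial>lborel)" (is "?L = ?R")
proof -
  have gm[measurable]: "g \<in> borel_measurable borel" by (rule borel_measurable_lborel_integrable[OF L1])
  let ?h = "\<lambda>n. 1 / real (Suc n)"
  let ?D = "\<lambda>n x. (g (x + ?h n *\<^sub>R v) - g x) / ?h n"
  let ?F = "\<lambda>n \<xi>. (2 * sin (?h n * (pi * (\<xi> \<bullet> v))) / ?h n)\<^sup>2 * (cmod (fourier g \<xi>))\<^sup>2"
  have h0: "?h \<longlonglongrightarrow> 0" by (rule LIMSEQ_Suc[OF lim_1_over_n])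
  have gt: "integrable lborel (\<lambda>x. g (x + c))" "integrable lborel (\<lambda>x. (g (x + c))\<^sup>2)" for c
    using lborel_integrable_translate[OF L1, of c] lborel_integrable_translate[OF L2, of c]
    by (simp_all add: add.commute)
  have P: "(\<integral>\<^sup>+\<xi>. ennreal (?F n \<xi>) \<partial>lborel) = (\<integral>\<^sup>+x. ennreal ((?D n x)\<^sup>2) \<partial>lborel)" for n
  proof -
    have D1: "integrable lborel (?D n)" using gt(1) L1 by simp
    \<comment> \<open>Expanding the square isolates the cross term, to which
      \<open>integrable_mult_L2\<close> applies.\<close>
    have "integrable lborel (\<lambda>x. ((g (x + ?h n *\<^sub>R v))\<^sup>2 + (g x)\<^sup>2 - 2 * (g (x + ?h n *\<^sub>R v) * g x)) / (?h n)\<^sup>2)"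
      by (intro integrable_divide_zero Bochner_Integration.integrable_diff
          Bochner_Integration.integrable_add integrable_mult_right integrable_mult_L2 gt L2) simp_all
    then have D2: "integrable lborel (\<lambda>x. (?D n x)\<^sup>2)"
      by (simp only: power_divide power2_diff mult.assoc)
    have "(\<integral>\<^sup>+\<xi>. ennreal (?F n \<xi>) \<partial>lborel) = (\<integral>\<^sup>+\<xi>. ennreal ((cmod (fourier (?D n) \<xi>))\<^sup>2) \<partial>lborel)"
      by (intro nn_integral_cong, subst fourier_difference_quotient[OF L1]) simp_all
    also have "\<dots> = ennreal (\<integral>x. (?D n x)\<^sup>2 \<partial>lborel)" by (rule plancherel[OF D1 D2])
    also have "\<dots> = (\<integral>\<^sup>+x. ennreal ((?D n x)\<^sup>2) \<partial>lborel)"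
      by (rule nn_integral_eq_integral[symmetric, OF D2]) simp
    finally show ?thesis .
  qed
  have limF: "(\<lambda>n. ennreal (?F n \<xi>)) \<longlonglongrightarrow> ennreal ((2 * pi * (\<xi> \<bullet> v))\<^sup>2 * (cmod (fourier g \<xi>))\<^sup>2)" for \<xi>
  proof -
    have "(\<lambda>n. (2 * sin (?h n * (pi * (\<xi> \<bullet> v))) / ?h n)\<^sup>2) \<longlonglongrightarrow> (2 * (pi * (\<xi> \<bullet> v)))\<^sup>2"
      by (intro tendsto_power sin_scaled_tendsto h0) simp
    then show ?thesis
      by (intro tendsto_ennrealI tendsto_mult_right) (simp only: mult.assoc)
  qed
  have limD: "(\<lambda>n. ennreal ((?D n x)\<^sup>2)) \<longlonglongrightarrow> ennreal ((g' x)\<^sup>2)" for x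
  proof -
    have "((\<lambda>t. (g (x + t *\<^sub>R v) - g x) / t) \<longlongrightarrow> g' x) (at 0)"
      using d[of x] by (simp add: DERIV_def)
    moreover have "filterlim ?h (at 0) sequentially"
      using h0 by (simp add: filterlim_at)
    ultimately have "(\<lambda>n. ?D n x) \<longlonglongrightarrow> g' x"
      by (rule filterlim_compose)
    then show ?thesis by (intro tendsto_ennrealI tendsto_power)
  qed
  \<comment> \<open>By \<open>\<bar>sin y\<bar> \<le> \<bar>y\<bar>\<close> each multiplier is at
    most its limit in absolute value.\<close>
  have boundF: "ennreal (?F n \<xi>) \<le> ennreal ((2 * pi * (\<xi> \<bullet> v))\<^sup>2 * (cmod (fourier g \<xi>))\<^sup>2)" for n \<xi>
  proof -
    have "\<bar>2 * sin (?h n * (pi * (\<xi> \<bullet> v))) / ?h n\<bar> = 2 * \<bar>sin (?h n * (pi * (\<xi> \<bullet> v)))\<bar> / ?h n"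
      by (simp add: abs_mult)
    also have "\<dots> \<le> 2 * \<bar>?h n * (pi * (\<xi> \<bullet> v))\<bar> / ?h n"
      by (intro divide_right_mono mult_left_mono abs_sin_x_le_abs_x) simp_all
    also have "\<dots> = \<bar>2 * pi * (\<xi> \<bullet> v)\<bar>" by (simp add: abs_mult)
    finally show ?thesis
      by (intro ennreal_leI mult_right_mono) (simp_all only: abs_le_square_iff zero_le_power2)
  qed
  show ?thesis
  proof (rule antisym)
    have "?L = (\<integral>\<^sup>+\<xi>. liminf (\<lambda>n. ennreal (?F n \<xi>)) \<partial>lborel)"
      using lim_imp_Liminf[OF _ limF] by simp
    also have "\<dots> \<le> liminf (\<lambda>n. \<integral>\<^sup>+\<xi>. ennreal (?F n \<xi>) \<partial>lborel)"
      by (rule nn_integral_liminf) simp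
    also have "\<dots> \<le> liminf (\<lambda>n. ?R)"
      unfolding P
      by (intro Liminf_mono always_eventually allI difference_quotient_L2_bound d) simp_all
    finally show "?L \<le> ?R" by (simp add: Liminf_const)
    \<comment> \<open>The mirror image of the first half: Fatou acts on the difference quotients,
      and \<open>boundF\<close> controls their transforms.\<close>
    have "?R = (\<integral>\<^sup>+x. liminf (\<lambda>n. ennreal ((?D n x)\<^sup>2)) \<partial>lborel)"
      using lim_imp_Liminf[OF _ limD] by simp
    also have "\<dots> \<le> liminf (\<lambda>n. \<integral>\<^sup>+x. ennreal ((?D n x)\<^sup>2) \<partial>lborel)"
      by (rule nn_integral_liminf) simp
    also have "\<dots> \<le> liminf (\<lambda>n. ?L)"
      unfolding P[symmetric]
      by (intro Liminf_mono always_eventually allI nn_integral_mono boundF)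
    finally show "?R \<le> ?L" by (simp add: Liminf_const)
  qed
qed

section \<open>Quaternions and reflections\<close>

lemma norm_power2_quat: "(norm (a, b, c, d))\<^sup>2 = a\<^sup>2 + b\<^sup>2 + c\<^sup>2 + d\<^sup>2" for a b c d :: real
  by (simp add: norm_Pair)

text \<open>The norm of the nested product type is Euclidean in the four coordinates, so results on
  normed spaces apply to the modulus.\<close>

lemma qabs_eq_norm: "qabs q = norm q"
proof (cases q)
  case (fields a b c d)
  have "qabs q = sqrt ((norm q)\<^sup>2)"
    unfolding fields norm_power2_quat
    by (simp add: qabs_def qmul_def qcnj_def qcomp_def power2_eq_square)
  then show ?thesis by simp
qed

lemma bounded_linear_qcomp: "bounded_linear (qcomp m)"
proof -
  have "qcomp m = (if m = 0 then (\<lambda>q. fst q) else if m = 1 then (\<lambda>q. fst (snd q))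
      else if m = 2 then (\<lambda>q. fst (snd (snd q))) else (\<lambda>q. snd (snd (snd q))))"
    by (auto simp: qcomp_def fun_eq_iff split: prod.split)
  moreover have "bounded_linear (\<lambda>q::quat. fst (snd q))"
      "bounded_linear (\<lambda>q::quat. fst (snd (snd q)))" "bounded_linear (\<lambda>q::quat. snd (snd (snd q)))"
    by (intro bounded_linear_compose[OF bounded_linear_fst] bounded_linear_compose[OF bounded_linear_snd]
        bounded_linear_snd)+
  ultimately show ?thesis by (simp add: bounded_linear_fst)
qed

lemma sum_qcomp_power2: "(\<Sum>m<4. (qcomp m q)\<^sup>2) = (norm q)\<^sup>2"
proof (cases q)
  case (fields a b c d)
  show ?thesis
    unfolding fields norm_power2_quat by (simp add: qcomp_def numeral_eq_Suc)
qed

lemma abs_qcomp_le: "\<bar>qcomp m q\<bar> \<le> norm q"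
proof (cases q)
  case (fields a b c d)
  have "(qcomp m q)\<^sup>2 \<le> (norm q)\<^sup>2"
    unfolding fields norm_power2_quat by (simp add: qcomp_def)
  then show ?thesis by (simp add: abs_le_square_iff[symmetric])
qed

lemma norm_qexp: "pure_unit \<mu> \<Longrightarrow> norm (qexp \<mu> \<theta>) = 1"
proof (cases \<mu>)
  case (fields a b c d)
  assume "pure_unit \<mu>"
  then have a: "a = 0" and n: "(norm (a, b, c, d))\<^sup>2 = 1"
    by (auto simp: pure_unit_def qabs_eq_norm fields qcomp_def)
  have "(norm (qexp \<mu> \<theta>))\<^sup>2 = (cos \<theta>)\<^sup>2 + (sin \<theta>)\<^sup>2 * (b\<^sup>2 + c\<^sup>2 + d\<^sup>2)"
    unfolding qexp_def qreal_def fields a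
    by (simp add: norm_power2_quat power_mult_distrib algebra_simps)
  also have "b\<^sup>2 + c\<^sup>2 + d\<^sup>2 = 1" using n unfolding norm_power2_quat a by simp
  finally have "(norm (qexp \<mu> \<theta>))\<^sup>2 = 1" by simp
  then show ?thesis by (simp add: power2_eq_1_iff) (smt (verit) norm_ge_zero)
qed

lemma qmul_qreal: "qmul (qreal r) q = r *\<^sub>R q"
  by (cases q) (simp add: qmul_def qreal_def)

text \<open>Differentiating the constant \<open>e s \<bullet> e s\<close> shows that
  \<open>e'\<close> is orthogonal to \<open>e t\<close>, so the cross terms of the squared norm
  vanish.\<close>

lemma norm_derivative_polar:
  fixes r :: "real \<Rightarrow> real" and e :: "real \<Rightarrow> 'a::real_inner"
  assumes r: "(r has_vector_derivative r') (at t)" and e: "(e has_vector_derivative e') (at t)"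
    and unit: "\<And>s. norm (e s) = 1"
  shows "((\<lambda>s. r s *\<^sub>R e s) has_vector_derivative (r t *\<^sub>R e' + r' *\<^sub>R e t)) (at t)"
    and "(norm (r t *\<^sub>R e' + r' *\<^sub>R e t))\<^sup>2 = r'\<^sup>2 + (r t)\<^sup>2 * (norm e')\<^sup>2"
proof -
  show "((\<lambda>s. r s *\<^sub>R e s) has_vector_derivative (r t *\<^sub>R e' + r' *\<^sub>R e t)) (at t)"
    using r e by (intro has_vector_derivative_scaleR) (simp_all add: has_real_derivative_iff_has_vector_derivative)
  have "((\<lambda>s. e s \<bullet> e s) has_vector_derivative (e t \<bullet> e' + e' \<bullet> e t)) (at t)"
    by (rule bounded_bilinear.has_vector_derivative[OF bounded_bilinear_inner e e])
  moreover have "(\<lambda>s. e s \<bullet> e s) = (\<lambda>s. 1)"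
    using unit by (simp add: power2_norm_eq_inner[symmetric])
  ultimately have "e t \<bullet> e' + e' \<bullet> e t = 0"
    using vector_derivative_unique_at[OF _ has_vector_derivative_const] by metis
  then have 0: "e' \<bullet> e t = 0" "e t \<bullet> e' = 0" by (simp_all add: inner_commute)
  have "e t \<bullet> e t = 1" using unit[of t] by (simp add: power2_norm_eq_inner[symmetric])
  then show "(norm (r t *\<^sub>R e' + r' *\<^sub>R e t))\<^sup>2 = r'\<^sup>2 + (r t)\<^sup>2 * (norm e')\<^sup>2"
    by (simp add: power2_norm_eq_inner inner_add_left inner_add_right 0) (simp add: power2_eq_square)
qed

section \<open>Reflection in a coordinate hyperplane\<close>

definition reflect :: "'a::euclidean_space \<Rightarrow> 'a \<Rightarrow> 'a" where
  "reflect b x = x - (2 * (x \<bullet> b)) *\<^sub>R b"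

lemma reflect_measurable[measurable]: "reflect b \<in> borel_measurable borel"
  unfolding reflect_def[abs_def] by measurable

text \<open>In coordinates the map is diagonal with a single entry -1 and all others 1, so its
  determinant has modulus 1.\<close>

lemma lborel_distr_reflect:
  fixes b :: "'a::euclidean_space"
  assumes b: "b \<in> Basis"
  shows "distr lborel borel (reflect b) = lborel"
proof -
  define c :: "'a \<Rightarrow> real" where "c j = (if j = b then - 1 else 1)" for j
  have "(\<Sum>j\<in>Basis. (c j * (x \<bullet> j)) *\<^sub>R j) = reflect b x" for x :: 'a
  proof -
    have "(\<Sum>j\<in>Basis. (c j * (x \<bullet> j)) *\<^sub>R j)
        = (\<Sum>j\<in>Basis. (x \<bullet> j) *\<^sub>R j - (if j = b then (2 * (x \<bullet> b)) *\<^sub>R b else 0))"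
      by (intro sum.cong) (auto simp: c_def scaleR_2[symmetric] simp flip: scaleR_left_diff_distrib)
    also have "\<dots> = reflect b x"
      using b by (simp add: sum_subtractf euclidean_representation reflect_def)
    finally show ?thesis .
  qed
  moreover have "(\<Prod>j\<in>Basis. \<bar>c j\<bar>) = 1" by (intro prod.neutral) (simp add: c_def)
  ultimately have "lborel = density (distr lborel borel (reflect b)) (\<lambda>_. 1)"
    using lborel_affine_euclidean[of c 0] by (simp add: c_def)
  then show ?thesis by (simp add: density_1)
qed

lemma nn_integral_reflect:
  fixes b :: "'a::euclidean_space"
  assumes "b \<in> Basis" "f \<in> borel_measurable borel"
  shows "(\<integral>\<^sup>+x. f (reflect b x) \<partial>lborel) = (\<integral>\<^sup>+x. f x \<partial>lborel)"
  by (subst (2) lborel_distr_reflect[OF assms(1), symmetric]) (simp add: nn_integral_distr assms(2))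

section \<open>The two-sided transform of a real function on the plane\<close>

lemma inner_real2: "(x::real^2) \<bullet> y = x $ 1 * y $ 1 + x $ 2 * y $ 2"
  by (simp add: inner_vec_def sum_2)

lemma reflect_axis2: "reflect (axis 2 1) (\<xi>::real^2) $ 1 = \<xi> $ 1" "reflect (axis 2 1) (\<xi>::real^2) $ 2 = - \<xi> $ 2"
proof -
  have "reflect (axis 2 1) \<xi> = \<xi> - (2 * \<xi> $ 2) *\<^sub>R axis 2 1"
    by (simp add: reflect_def inner_axis)
  then show "reflect (axis 2 1) \<xi> $ 1 = \<xi> $ 1" "reflect (axis 2 1) \<xi> $ 2 = - \<xi> $ 2"
    by (simp_all add: axis_def)
qed

text \<open>Both coordinate embeddings are bounded linear, so they commute with the integral. Nested
  use evaluates a quaternion integral coordinatewise.\<close>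

lemma integral_Pair:
  fixes f :: "'a \<Rightarrow> 'b::{banach, second_countable_topology}" and g :: "'a \<Rightarrow> 'c::{banach, second_countable_topology}"
  assumes "integrable M f" "integrable M g"
  shows "(\<integral>x. (f x, g x) \<partial>M) = (\<integral>x. f x \<partial>M, \<integral>x. g x \<partial>M)"
    and "integrable M (\<lambda>x. (f x, g x))"
proof -
  have l: "bounded_linear (\<lambda>x::'b. (x, 0::'c))" "bounded_linear (\<lambda>x::'c. (0::'b, x))"
    by (auto intro: bounded_linear_Pair bounded_linear_ident bounded_linear_zero)
  have eq: "(\<lambda>x. (f x, g x)) = (\<lambda>x. (f x, 0) + (0, g x))" by simp
  note i = integrable_bounded_linear[OF l(1) assms(1)] integrable_bounded_linear[OF l(2) assms(2)]
  show "integrable M (\<lambda>x. (f x, g x))" unfolding eq using i by (rule Bochner_Integration.integrable_add)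
  show "(\<integral>x. (f x, g x) \<partial>M) = (\<integral>x. f x \<partial>M, \<integral>x. g x \<partial>M)"
    unfolding eq Bochner_Integration.integral_add[OF i]
      integral_bounded_linear[OF l(1) assms(1)] integral_bounded_linear[OF l(2) assms(2)] by simp
qed

text \<open>As ij = k, the integrand has the coordinates \<open>?cc\<close>, \<open>?sc\<close>,
  \<open>?cs\<close>, \<open>?ss\<close>. The complex transforms at \<open>\<xi>\<close> and at its
  reflection combine their integrals as cc - ss, sc + cs and as cc + ss, sc - cs, and the
  parallelogram identity concludes.\<close>

lemma qft_real_norm:
  fixes g :: "real^2 \<Rightarrow> real"
  assumes g: "integrable lborel g"
  shows "(qabs (qft (\<lambda>x. qreal (g x)) \<xi>))\<^sup>2
       = ((cmod (fourier g \<xi>))\<^sup>2 + (cmod (fourier g (reflect (axis 2 1) \<xi>)))\<^sup>2) / 2"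
proof -
  let ?a = "\<lambda>x::real^2. -2 * pi * (\<xi> $ 1) * (x $ 1)" and ?b = "\<lambda>x::real^2. -2 * pi * (\<xi> $ 2) * (x $ 2)"
  let ?cc = "\<lambda>x. g x * (cos (?a x) * cos (?b x))" and ?sc = "\<lambda>x. g x * (sin (?a x) * cos (?b x))"
    and ?cs = "\<lambda>x. g x * (cos (?a x) * sin (?b x))" and ?ss = "\<lambda>x. g x * (sin (?a x) * sin (?b x))"
  have [measurable]: "g \<in> borel_measurable borel" by (rule borel_measurable_lborel_integrable[OF g])
  have bound: "integrable lborel (\<lambda>x. g x * (p x * q x))"
    if [measurable]: "p \<in> borel_measurable borel" "q \<in> borel_measurable borel"
      and le: "\<And>x. \<bar>p x\<bar> \<le> 1" "\<And>x. \<bar>q x\<bar> \<le> 1" for p q :: "real^2 \<Rightarrow> real"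
  proof (rule Bochner_Integration.integrable_bound[OF g])
    have "\<bar>p x\<bar> * \<bar>q x\<bar> \<le> 1" for x using mult_mono[OF le(1)[of x] le(2)[of x]] by simp
    then show "AE x in lborel. norm (g x * (p x * q x)) \<le> norm (g x)"
      by (intro AE_I2) (simp add: abs_mult mult_left_le)
  qed simp
  have i: "integrable lborel ?cc" "integrable lborel ?sc" "integrable lborel ?cs" "integrable lborel ?ss"
    by (rule bound; simp)+
  have "qft (\<lambda>x. qreal (g x)) \<xi> = (\<integral>x. (?cc x, ?sc x, ?cs x, ?ss x) \<partial>lborel)"
    unfolding qft_def
    by (intro Bochner_Integration.integral_cong refl)
      (simp add: qexp_def qi_def qj_def qreal_def qmul_def algebra_simps)
  also have "\<dots> = (\<integral>x. ?cc x \<partial>lborel, \<integral>x. ?sc x \<partial>lborel, \<integral>x. ?cs x \<partial>lborel, \<integral>x. ?ss x \<partial>lborel)"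
    using i by (simp only: integral_Pair)
  finally have q: "(qabs (qft (\<lambda>x. qreal (g x)) \<xi>))\<^sup>2
      = (\<integral>x. ?cc x \<partial>lborel)\<^sup>2 + (\<integral>x. ?sc x \<partial>lborel)\<^sup>2 + (\<integral>x. ?cs x \<partial>lborel)\<^sup>2 + (\<integral>x. ?ss x \<partial>lborel)\<^sup>2"
    unfolding qabs_eq_norm by (simp only: norm_power2_quat)
  \<comment> \<open>The sign \<open>\<sigma>\<close> treats both frequencies at once: 1 for
    \<open>\<xi>\<close> and -1 for its reflection, which changes only the sine of the second
    angle.\<close>
  have F: "fourier g \<eta> = Complex ((\<integral>x. ?cc x \<partial>lborel) - \<sigma> * (\<integral>x. ?ss x \<partial>lborel))
      ((\<integral>x. ?sc x \<partial>lborel) + \<sigma> * (\<integral>x. ?cs x \<partial>lborel))"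
    if \<eta>: "\<eta> $ 1 = \<xi> $ 1" "\<eta> $ 2 = \<sigma> * \<xi> $ 2" and \<sigma>: "\<sigma> = 1 \<or> \<sigma> = -1" for \<eta> \<sigma>
  proof -
    have trig: "cos (\<sigma> * t) = cos t" "sin (\<sigma> * t) = \<sigma> * sin t" for t using \<sigma> by auto
    have arg: "- (2 * pi) * (\<eta> \<bullet> x) = ?a x + \<sigma> * ?b x" for x
      unfolding inner_real2 \<eta> by (simp add: algebra_simps)
    note ig = integrable_fourier_integrand[OF g, of "- (2 * pi)" \<eta>]
    have "Re (fourier g \<eta>) = (\<integral>x. Re (g x *\<^sub>R cis (- (2 * pi) * (\<eta> \<bullet> x))) \<partial>lborel)"
      unfolding fourier_def by (rule integral_Re[OF ig, symmetric])
    also have "\<dots> = (\<integral>x. ?cc x - \<sigma> * ?ss x \<partial>lborel)"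
      unfolding arg by (intro Bochner_Integration.integral_cong refl)
        (simp only: scaleR_complex.sel cis.sel cos_add trig, simp add: algebra_simps)
    also have "\<dots> = (\<integral>x. ?cc x \<partial>lborel) - \<sigma> * (\<integral>x. ?ss x \<partial>lborel)"
      using i by simp
    finally have Re: "Re (fourier g \<eta>) = \<dots>" .
    have "Im (fourier g \<eta>) = (\<integral>x. Im (g x *\<^sub>R cis (- (2 * pi) * (\<eta> \<bullet> x))) \<partial>lborel)"
      unfolding fourier_def by (rule integral_Im[OF ig, symmetric])
    also have "\<dots> = (\<integral>x. ?sc x + \<sigma> * ?cs x \<partial>lborel)"
      unfolding arg by (intro Bochner_Integration.integral_cong refl)
        (simp only: scaleR_complex.sel cis.sel sin_add trig, simp add: algebra_simps)
    also have "\<dots> = (\<integral>x. ?sc x \<partial>lborel) + \<sigma> * (\<integral>x. ?cs x \<partial>lborel)"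
      using i by simp
    finally have Im: "Im (fourier g \<eta>) = \<dots>" .
    show ?thesis by (rule complex_eqI) (simp_all only: Re Im complex.sel)
  qed
  have "fourier g \<xi> = Complex ((\<integral>x. ?cc x \<partial>lborel) - 1 * (\<integral>x. ?ss x \<partial>lborel))
      ((\<integral>x. ?sc x \<partial>lborel) + 1 * (\<integral>x. ?cs x \<partial>lborel))"
    by (rule F) simp_all
  moreover have "fourier g (reflect (axis 2 1) \<xi>) = Complex ((\<integral>x. ?cc x \<partial>lborel) - (-1) * (\<integral>x. ?ss x \<partial>lborel))
      ((\<integral>x. ?sc x \<partial>lborel) + (-1) * (\<integral>x. ?cs x \<partial>lborel))"
    by (rule F) (simp_all add: reflect_axis2)
  ultimately show ?thesis
    unfolding q cmod_power2 by (simp only: complex.sel) (simp add: power2_eq_square algebra_simps)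
qed

section \<open>Partial derivatives and the weighted identity for a real component\<close>

lemma partial_derivative:
  assumes "partial_differentiable k g x"
  shows "((\<lambda>t. g (x + t *\<^sub>R axis k 1)) has_vector_derivative pdiff k g x) (at 0)"
  using assms unfolding partial_differentiable_def pdiff_def vector_derivative_works .

text \<open>The derivative is a pointwise limit of measurable difference quotients with increments
  \<open>1 / real (Suc n)\<close>.\<close>

lemma pdiff_measurable:
  fixes g :: "real^2 \<Rightarrow> real"
  assumes g[measurable]: "g \<in> borel_measurable borel" and d: "\<And>x. partial_differentiable k g x"
  shows "pdiff k g \<in> borel_measurable borel"
proof (rule borel_measurable_LIMSEQ_real)
  let ?h = "\<lambda>n. 1 / real (Suc n)"
  show "(\<lambda>n. (g (x + ?h n *\<^sub>R axis k 1) - g x) / ?h n) \<longlonglongrightarrow> pdiff k g x" for x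
  proof (rule filterlim_compose[where g = "\<lambda>t. (g (x + t *\<^sub>R axis k 1) - g x) / t"])
    show "((\<lambda>t. (g (x + t *\<^sub>R axis k 1) - g x) / t) \<longlongrightarrow> pdiff k g x) (at 0)"
      using partial_derivative[OF d[of x]]
      by (simp add: has_real_derivative_iff_has_vector_derivative[symmetric] DERIV_def)
    show "filterlim ?h (at 0) sequentially"
      using LIMSEQ_Suc[OF lim_1_over_n] by (simp add: filterlim_at)
  qed
qed measurable

text \<open>By \<open>qft_real_norm\<close> the integral is the mean of two. The reflection
  preserves Lebesgue measure and \<open>(\<xi> $ k)\<^sup>2\<close>, so each of them is the integral
  in \<open>plancherel_derivative\<close>.\<close>

lemma qft_real_plancherel_derivative:
  fixes g g' :: "real^2 \<Rightarrow> real" and k :: 2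
  assumes L1: "integrable lborel g" and L2: "integrable lborel (\<lambda>x. (g x)\<^sup>2)"
    and d: "\<And>x. ((\<lambda>t. g (x + t *\<^sub>R axis k 1)) has_real_derivative g' x) (at 0)"
    and m: "g' \<in> borel_measurable borel"
  shows "(\<lambda>\<xi>. qabs (qft (\<lambda>x. qreal (g x)) \<xi>)) \<in> borel_measurable borel"
    and "(\<integral>\<^sup>+\<xi>. ennreal ((2 * pi * \<xi> $ k)\<^sup>2 * (qabs (qft (\<lambda>x. qreal (g x)) \<xi>))\<^sup>2) \<partial>lborel)
       = (\<integral>\<^sup>+x. ennreal ((g' x)\<^sup>2) \<partial>lborel)"
proof -
  note [measurable] = borel_measurable_lborel_integrable[OF L1]
  let ?R = "reflect (axis 2 1) :: real^2 \<Rightarrow> real^2"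
  have "(\<lambda>\<xi>. sqrt ((qabs (qft (\<lambda>x. qreal (g x)) \<xi>))\<^sup>2)) \<in> borel_measurable borel"
    unfolding qft_real_norm[OF L1] by measurable
  then show "(\<lambda>\<xi>. qabs (qft (\<lambda>x. qreal (g x)) \<xi>)) \<in> borel_measurable borel"
    by (simp add: qabs_eq_norm)
  let ?F = "\<lambda>\<xi>. ennreal ((2 * pi * \<xi> $ k)\<^sup>2 * (cmod (fourier g \<xi>))\<^sup>2)"
  have k: "(?R \<xi> $ k)\<^sup>2 = (\<xi> $ k)\<^sup>2" for \<xi>
    using exhaust_2[of k] by (auto simp: reflect_axis2)
  have FM: "?F \<in> borel_measurable borel" by measurable
  have FR: "(\<lambda>\<xi>. ?F (?R \<xi>)) \<in> borel_measurable borel"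
    by (rule measurable_compose[OF reflect_measurable FM])
  have half: "ennreal (a * ((b + c) / 2)) = ennreal (1 / 2) * (ennreal (a * b) + ennreal (a * c))"
    if "0 \<le> a" "0 \<le> b" "0 \<le> c" for a b c :: real
  proof -
    have "ennreal (a * ((b + c) / 2)) = ennreal (1 / 2 * (a * b + a * c))"
      by (simp add: algebra_simps add_divide_distrib)
    also have "\<dots> = ennreal (1 / 2) * (ennreal (a * b) + ennreal (a * c))"
      using that by (subst ennreal_mult) simp_all
    finally show ?thesis .
  qed
  have "(\<integral>\<^sup>+\<xi>. ?F \<xi> \<partial>lborel) = (\<integral>\<^sup>+x. ennreal ((g' x)\<^sup>2) \<partial>lborel)"
    using plancherel_derivative[OF L1 L2 d m] by (simp add: inner_axis)
  moreover have "(\<integral>\<^sup>+\<xi>. ?F (?R \<xi>) \<partial>lborel) = (\<integral>\<^sup>+\<xi>. ?F \<xi> \<partial>lborel)"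
    by (rule nn_integral_reflect) (simp_all add: axis_in_Basis_iff)
  moreover have "(\<integral>\<^sup>+\<xi>. ennreal ((2 * pi * \<xi> $ k)\<^sup>2 * (qabs (qft (\<lambda>x. qreal (g x)) \<xi>))\<^sup>2) \<partial>lborel)
      = ennreal (1 / 2) * ((\<integral>\<^sup>+\<xi>. ?F \<xi> \<partial>lborel) + (\<integral>\<^sup>+\<xi>. ?F (?R \<xi>) \<partial>lborel))"
  proof -
    have "(\<integral>\<^sup>+\<xi>. ennreal ((2 * pi * \<xi> $ k)\<^sup>2 * (qabs (qft (\<lambda>x. qreal (g x)) \<xi>))\<^sup>2) \<partial>lborel)
        = (\<integral>\<^sup>+\<xi>. ennreal (1 / 2) * (?F \<xi> + ?F (?R \<xi>)) \<partial>lborel)"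
      unfolding qft_real_norm[OF L1] power_mult_distrib k
      by (intro nn_integral_cong half) simp_all
    also have "\<dots> = ennreal (1 / 2) * (\<integral>\<^sup>+\<xi>. ?F \<xi> + ?F (?R \<xi>) \<partial>lborel)"
      by (rule nn_integral_cmult) (use borel_measurable_add[OF FM FR] in simp)
    also have "(\<integral>\<^sup>+\<xi>. ?F \<xi> + ?F (?R \<xi>) \<partial>lborel)
        = (\<integral>\<^sup>+\<xi>. ?F \<xi> \<partial>lborel) + (\<integral>\<^sup>+\<xi>. ?F (?R \<xi>) \<partial>lborel)"
      by (rule nn_integral_add) (use FM FR in simp_all)
    finally show ?thesis .
  qed
  moreover have "ennreal (1 / 2) * (r + r) = r" for r
  proof -
    have "ennreal (1 / 2) * (r + r) = (ennreal (1 / 2) * 2) * r"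
      by (simp add: mult_2[symmetric] mult.assoc)
    also have "ennreal (1 / 2) * 2 = 1"
      by (subst ennreal_numeral[symmetric], subst ennreal_mult[symmetric]) simp_all
    finally show ?thesis by simp
  qed
  ultimately show "(\<integral>\<^sup>+\<xi>. ennreal ((2 * pi * \<xi> $ k)\<^sup>2 * (qabs (qft (\<lambda>x. qreal (g x)) \<xi>))\<^sup>2) \<partial>lborel)
       = (\<integral>\<^sup>+x. ennreal ((g' x)\<^sup>2) \<partial>lborel)" by simp
qed

section \<open>Summation over the components and the polar decomposition\<close>

theorem theorem3p9:
  fixes f :: "real^2 \<Rightarrow> quat" and u :: "real^2 \<Rightarrow> quat" and \<theta> :: "real^2 \<Rightarrow> real"
    and k :: 2
  assumes L1: "qL1 f" and L2: "qL2 f"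
    and polar: "\<And>x. f x = qmul (qreal (qabs (f x))) (qexp (u x) (\<theta> x))"
    and pure: "\<And>x. pure_unit (u x)"
    and diff_abs: "\<And>x. partial_differentiable k (\<lambda>y. qabs (f y)) x"
    and diff_exp: "\<And>x. partial_differentiable k (\<lambda>y. qexp (u y) (\<theta> y)) x"
    and diff_f: "\<And>x. partial_differentiable k f x"
    and deriv_L2: "qL2 (pdiff k f)"
  shows "(2 * pi)\<^sup>2 * (\<integral>\<xi>. (\<xi>$k)\<^sup>2 * (qft_norm f \<xi>)\<^sup>2 \<partial>lborel)
       = (\<integral>x. (pdiff k (\<lambda>y. qabs (f y)) x)\<^sup>2 \<partial>lborel)
         + (\<integral>x. (qabs (f x))\<^sup>2 * (qabs (pdiff k (\<lambda>y. qexp (u y) (\<theta> y)) x))\<^sup>2 \<partial>lborel)"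
proof -
  let ?e = "\<lambda>x. qexp (u x) (\<theta> x)" and ?r = "\<lambda>x. norm (f x)"
  let ?df = "\<lambda>m x. qcomp m (pdiff k f x)"
  have f1: "integrable lborel f" using L1 by (simp add: qL1_def)
  have f2: "integrable lborel (\<lambda>x. (norm (f x))\<^sup>2)" using L2 by (simp add: qL2_def qabs_eq_norm)
  have fm[measurable]: "f \<in> borel_measurable borel" by (rule borel_measurable_lborel_integrable[OF f1])
  have dm[measurable]: "pdiff k f \<in> borel_measurable borel"
    and d2: "integrable lborel (\<lambda>x. (norm (pdiff k f x))\<^sup>2)"
    using deriv_L2 by (simp_all add: qL2_def qabs_eq_norm)
  have qm[measurable]: "qcomp m \<in> borel_measurable borel" for m
    by (intro borel_measurable_continuous_onI linear_continuous_on bounded_linear_qcomp)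

  have comp1: "integrable lborel (\<lambda>x. qcomp m (f x))" for m
    by (rule integrable_bounded_linear[OF bounded_linear_qcomp f1])
  have comp2: "integrable lborel (\<lambda>x. (qcomp m (f x))\<^sup>2)" for m
  proof (rule Bochner_Integration.integrable_bound[OF f2])
    show "AE x in lborel. norm ((qcomp m (f x))\<^sup>2) \<le> norm ((norm (f x))\<^sup>2)"
      using abs_qcomp_le by (intro AE_I2) (simp add: abs_le_square_iff[symmetric])
  qed measurable
  have comp_d: "((\<lambda>t. qcomp m (f (x + t *\<^sub>R axis k 1))) has_real_derivative ?df m x) (at 0)" for m x
    unfolding has_real_derivative_iff_has_vector_derivative
    by (rule bounded_linear.has_vector_derivative[OF bounded_linear_qcomp partial_derivative[OF diff_f]])
  note comp = qft_real_plancherel_derivative[OF comp1 comp2 comp_d, of _]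
  have [measurable]: "(\<lambda>\<xi>. qabs (qft (\<lambda>x. qreal (qcomp m (f x))) \<xi>)) \<in> borel_measurable borel" for m
    by (rule comp(1)) measurable
  have compm: "(\<lambda>\<xi>. ennreal ((2 * pi * \<xi> $ k)\<^sup>2 * (qabs (qft (\<lambda>x. qreal (qcomp m (f x))) \<xi>))\<^sup>2))
      \<in> borel_measurable borel" for m
    by measurable
  have nmeas[measurable]: "qft_norm f \<in> borel_measurable borel"
    unfolding qft_norm_def[abs_def] by measurable

  \<comment> \<open>Nonnegative integrals let the sum over the four components pass through freely;
    finiteness enters only at the end, from the derivative being in L^2.\<close>
  have "(\<integral>\<^sup>+\<xi>. ennreal ((2 * pi)\<^sup>2 * ((\<xi>$k)\<^sup>2 * (qft_norm f \<xi>)\<^sup>2)) \<partial>lborel)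
      = (\<integral>\<^sup>+\<xi>. (\<Sum>m<4. ennreal ((2 * pi * \<xi> $ k)\<^sup>2 * (qabs (qft (\<lambda>x. qreal (qcomp m (f x))) \<xi>))\<^sup>2)) \<partial>lborel)"
    by (intro nn_integral_cong)
      (simp add: qft_norm_def sum_nonneg sum_distrib_left power_mult_distrib mult.assoc)
  also have "\<dots> = (\<Sum>m<4. \<integral>\<^sup>+\<xi>. ennreal ((2 * pi * \<xi> $ k)\<^sup>2 * (qabs (qft (\<lambda>x. qreal (qcomp m (f x))) \<xi>))\<^sup>2) \<partial>lborel)"
    by (rule nn_integral_sum) (simp add: compm)
  also have "\<dots> = (\<Sum>m<4. \<integral>\<^sup>+x. ennreal ((?df m x)\<^sup>2) \<partial>lborel)"
    by (intro sum.cong refl comp(2)) measurable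
  also have "\<dots> = (\<integral>\<^sup>+x. (\<Sum>m<4. ennreal ((?df m x)\<^sup>2)) \<partial>lborel)"
    by (rule nn_integral_sum[symmetric]) measurable
  also have "\<dots> = (\<integral>\<^sup>+x. ennreal ((norm (pdiff k f x))\<^sup>2) \<partial>lborel)"
    by (intro nn_integral_cong) (simp add: sum_qcomp_power2)
  also have "\<dots> = ennreal (\<integral>x. (norm (pdiff k f x))\<^sup>2 \<partial>lborel)"
    by (rule nn_integral_eq_integral[OF d2]) simp
  finally have nn: "(\<integral>\<^sup>+\<xi>. ennreal ((2 * pi)\<^sup>2 * ((\<xi>$k)\<^sup>2 * (qft_norm f \<xi>)\<^sup>2)) \<partial>lborel)
      = ennreal (\<integral>x. (norm (pdiff k f x))\<^sup>2 \<partial>lborel)" .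
  \<comment> \<open>The constant moves inside without an integrability proof, as a function that is
    not integrable has Bochner integral 0.\<close>
  have "(2 * pi)\<^sup>2 * (\<integral>\<xi>. (\<xi>$k)\<^sup>2 * (qft_norm f \<xi>)\<^sup>2 \<partial>lborel)
      = (\<integral>\<xi>. (2 * pi)\<^sup>2 * ((\<xi>$k)\<^sup>2 * (qft_norm f \<xi>)\<^sup>2) \<partial>lborel)"
    by (rule integral_mult_right_zero[symmetric])
  also have "\<dots> = (\<integral>x. (norm (pdiff k f x))\<^sup>2 \<partial>lborel)"
    by (subst integral_eq_nn_integral) (simp_all only: nn, simp_all)
  finally have lhs: "(2 * pi)\<^sup>2 * (\<integral>\<xi>. (\<xi>$k)\<^sup>2 * (qft_norm f \<xi>)\<^sup>2 \<partial>lborel) = \<dots>" .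

  have pt: "(norm (pdiff k f x))\<^sup>2 = (pdiff k ?r x)\<^sup>2 + (norm (f x))\<^sup>2 * (norm (pdiff k ?e x))\<^sup>2" for x
  proof -
    have fe: "f y = norm (f y) *\<^sub>R ?e y" for y
      using polar[of y] by (simp only: qmul_qreal qabs_eq_norm)
    let ?l = "\<lambda>t. x + t *\<^sub>R axis k 1"
    have r: "((\<lambda>t. ?r (?l t)) has_vector_derivative pdiff k ?r x) (at 0)"
      using partial_derivative[OF diff_abs] by (simp only: qabs_eq_norm)
    have e: "((\<lambda>t. ?e (?l t)) has_vector_derivative pdiff k ?e x) (at 0)"
      by (rule partial_derivative[OF diff_exp])
    note p = norm_derivative_polar[OF r e norm_qexp[OF pure]]
    have "((\<lambda>t. f (?l t)) has_vector_derivative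
        (?r (?l 0) *\<^sub>R pdiff k ?e x + pdiff k ?r x *\<^sub>R ?e (?l 0))) (at 0)"
      using p(1) unfolding fe[symmetric] .
    from vector_derivative_unique_at[OF partial_derivative[OF diff_f] this]
    show ?thesis using p(2) by simp
  qed
  have rm[measurable]: "pdiff k ?r \<in> borel_measurable borel"
    using diff_abs by (intro pdiff_measurable) (simp_all add: qabs_eq_norm)
  have i1: "integrable lborel (\<lambda>x. (pdiff k ?r x)\<^sup>2)"
  proof (rule Bochner_Integration.integrable_bound[OF d2])
    show "AE x in lborel. norm ((pdiff k ?r x)\<^sup>2) \<le> norm ((norm (pdiff k f x))\<^sup>2)"
      unfolding pt by simp
  qed measurable
  \<comment> \<open>\<open>?e\<close> is tied to \<open>f\<close> only where \<open>f\<close> is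
    nonzero, and \<open>u\<close> and \<open>\<theta>\<close> are not assumed measurable. Writing
    the second summand as a difference of integrable functions yields its measurability along with
    its integrability.\<close>
  have "integrable lborel (\<lambda>x. (norm (pdiff k f x))\<^sup>2 - (pdiff k ?r x)\<^sup>2)"
    using d2 i1 by simp
  then have i2: "integrable lborel (\<lambda>x. (norm (f x))\<^sup>2 * (norm (pdiff k ?e x))\<^sup>2)"
    unfolding pt by simp
  show ?thesis
    unfolding lhs qabs_eq_norm using Bochner_Integration.integral_add[OF i1 i2] by (simp only: pt)
qed

end
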